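(* Let $d\ge 2$, let $G$ be a locally compact group with operation $*$, and let $f,g:G\times[-1,1]\to\mathbb{C}$ be continuous functions which are the isotropic parts of positive definite kernels on $G\times S^d$, with series representations $$f(u,t)=\sum_{k=0}^\infty a_k^d(f;u)C_k^{(d-1)/2}(t),\qquad g(u,t)=\sum_{k=0}^\infty a_k^d(g;u)C_k^{(d-1)/2}(t),\qquad (u,t)\in G\times[-1,1].$$ The following assertions are equivalent: (i) the product $fg$ is the isotropic part of a strictly positive definite kernel on $G\times S^d$; (ii) for every $p\ge 1$, all distinct points $u_1,u_2,\dots,u_p$ in $G$ and every nonzero vector $c\in\mathbb{C}^p$, the set $$\Big\{k+l:\ k,l\in\mathbb{Z}_+,\ c^t\big[a_k^d(f;u_\mu^{-1}*u_\nu)\,a_l^d(g;u_\mu^{-1}*u_\nu)\big]_{\mu,\nu=1}^p\,\overline{c}>0\Big\}$$ contains infinitely many even and infinitely many odd integers.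
   Context: $S^d$ is the unit sphere in $\mathbb{R}^{d+1}$, with geodesic distance $|xy|$ normalized so that the largest distance equals $2\pi$; thus $\cos(|xy|/2)=x\cdot y$, the usual inner product. A continuous function $f:G\times[-1,1]\to\mathbb{C}$ is called the isotropic part of the kernel on $G\times S^d$ given by $$K((u,x),(v,y))=f\big(u^{-1}*v,\cos(|xy|/2)\big),\qquad (u,x),(v,y)\in G\times S^d.$$ A kernel $K$ on a set $X$ (here $X=G\times S^d$) is positive definite if $\sum_{i,j=1}^n c_i\overline{c_j}K(y_i,y_j)\ge0$ for all $n\ge1$, all distinct $y_1,\dots,y_n\in X$ and all complex $c_1,\dots,c_n$; it is strictly positive definite if in addition the inequality is strict whenever $c_1,\dots,c_n$ are not all zero. By a theorem of Berg and Porcu, a continuous $f$ is the isotropic part of a positive definite kernel on $G\times S^d$ if and only if $$f(u,t)=\sum_{k=0}^\infty a_k^d(f;u)C_k^{(d-1)/2}(t),\qquad (u,t)\in G\times[-1,1],$$ where each $a_k^d(f;\cdot)$ is a continuous function on $G$ such that the kernel $(u,v)\in G^2\mapsto a_k^d(f;u^{-1}*v)$ is positive definite, and $\sum_k a_k^d(f;e)C_k^{(d-1)/2}(1)<\infty$, with $e$ the neutral element of $G$. Here $C_k^{(d-1)/2}$ is the Gegenbauer polynomial of degree $k$. The coefficient functions are uniquely determined by $f$: $a_k^d(f;u)=c(k,d)\int_{-1}^1 f(u,s)C_k^{(d-1)/2}(s)(1-s^2)^{(d-2)/2}\,ds$ with $c(k,d)$ a normalization constant. $\mathbb{Z}_+$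 is the set of nonnegative integers, and $c^t$ denotes the transpose of the column vector $c$. *)

theory Defs
  imports
    "HOL-Analysis.Analysis"
    "HOL-Algebra.Group"
    "HOL-Library.Complex_Order"
begin

text \<open>The Hausdorff axiom is not part of this definition, so that results stated with it
  hold under either convention.\<close>

definition locally_compact_group :: "('g, 'm) monoid_scheme \<Rightarrow> 'g topology \<Rightarrow> bool" where
  "locally_compact_group G T \<longleftrightarrow>
     group G \<and> topspace T = carrier G \<and>
     continuous_map (prod_topology T T) T (\<lambda>(u, v). u \<otimes>\<^bsub>G\<^esub> v) \<and>
     continuous_map T T (\<lambda>u. inv\<^bsub>G\<^esub> u) \<and>
     locally_compact_space T"

text \<open>The value of $c^t A \overline{c}$ for a $p \times p$ matrix $A$, with indices running
  from $0$ to $p - 1$.\<close>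

definition sesq_form :: "nat \<Rightarrow> (nat \<Rightarrow> nat \<Rightarrow> complex) \<Rightarrow> (nat \<Rightarrow> complex) \<Rightarrow> complex" where
  "sesq_form p A c = (\<Sum>i<p. \<Sum>j<p. c i * A i j * cnj (c j))"

text \<open>The order on the complex numbers is that of \<^theory>\<open>HOL-Library.Complex_Order\<close>:
  both $0 \le z$ and $0 < z$ entail that $z$ is real.\<close>

definition positive_definite_on :: "'x set \<Rightarrow> ('x \<Rightarrow> 'x \<Rightarrow> complex) \<Rightarrow> bool" where
  "positive_definite_on X K \<longleftrightarrow>
     (\<forall>n\<ge>1. \<forall>y c. y ` {..<n} \<subseteq> X \<and> inj_on y {..<n} \<longrightarrow>
        0 \<le> sesq_form n (\<lambda>i j. K (y i) (y j)) c)"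

definition strictly_positive_definite_on :: "'x set \<Rightarrow> ('x \<Rightarrow> 'x \<Rightarrow> complex) \<Rightarrow> bool" where
  "strictly_positive_definite_on X K \<longleftrightarrow>
     positive_definite_on X K \<and>
     (\<forall>n\<ge>1. \<forall>y c. y ` {..<n} \<subseteq> X \<and> inj_on y {..<n} \<and> (\<exists>i<n. c i \<noteq> 0) \<longrightarrow>
        0 < sesq_form n (\<lambda>i j. K (y i) (y j)) c)"

text \<open>Geodesic distance on the unit sphere, scaled so that antipodal points have distance
  $2\pi$.\<close>

definition sphere_dist :: "'b::euclidean_space \<Rightarrow> 'b \<Rightarrow> real" where
  "sphere_dist x y = 2 * arccos (x \<bullet> y)"

lemma cos_sphere_dist:
  assumes "x \<in> sphere 0 1" "y \<in> sphere 0 1"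
  shows "cos (sphere_dist x y / 2) = x \<bullet> y"
proof -
  have "\<bar>x \<bullet> y\<bar> \<le> 1"
    using Cauchy_Schwarz_ineq2[of x y] assms by simp
  then show ?thesis
    by (simp add: sphere_dist_def cos_arccos_abs)
qed

text \<open>A function on $G \times [-1,1]$ is rendered as a total curried function; only its values
  at arguments in \<^term>\<open>carrier G\<close> and $[-1,1]$ are ever used.\<close>

definition isotropic_part ::
  "('g, 'm) monoid_scheme \<Rightarrow> 'g topology \<Rightarrow> ('g \<Rightarrow> real \<Rightarrow> complex) \<Rightarrow>
   ('g \<times> 'b::euclidean_space \<Rightarrow> 'g \<times> 'b \<Rightarrow> complex) \<Rightarrow> bool" where
  "isotropic_part G T f K \<longleftrightarrow>
     continuous_map (prod_topology T (top_of_set {-1..1})) euclidean (\<lambda>(u, t). f u t) \<and>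
     (\<forall>u\<in>carrier G. \<forall>v\<in>carrier G. \<forall>x\<in>sphere 0 1. \<forall>y\<in>sphere 0 1.
        K (u, x) (v, y) = f (inv\<^bsub>G\<^esub> u \<otimes>\<^bsub>G\<^esub> v) (cos (sphere_dist x y / 2)))"

text \<open>\<open>gegenbauer \<alpha> k t\<close> is $C_k^{\alpha}(t)$ in the standard normalization
  $\sum_k C_k^{\alpha}(t) r^k = (1 - 2 t r + r^2)^{-\alpha}$, given by the three-term
  recurrence.\<close>

fun gegenbauer :: "real \<Rightarrow> nat \<Rightarrow> real \<Rightarrow> real" where
  "gegenbauer \<alpha> 0 t = 1"
| "gegenbauer \<alpha> (Suc 0) t = 2 * \<alpha> * t"
| "gegenbauer \<alpha> (Suc (Suc k)) t =
     (2 * (real k + 1 + \<alpha>) * t * gegenbauer \<alpha> (Suc k) t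
        - (real k + 2 * \<alpha>) * gegenbauer \<alpha> k t) / (real k + 2)"

text \<open>The Berg--Porcu representation of $f$ with coefficient functions
  $a_k = a_k^d(f;\cdot)$.  These are determined on \<^term>\<open>carrier G\<close> by $f$: the conditions
  force the series to converge absolutely and uniformly in $t$, and the Gegenbauer polynomials
  are orthogonal.\<close>

definition gegenbauer_series ::
  "('g, 'm) monoid_scheme \<Rightarrow> 'g topology \<Rightarrow> nat \<Rightarrow> ('g \<Rightarrow> real \<Rightarrow> complex) \<Rightarrow>
   (nat \<Rightarrow> 'g \<Rightarrow> complex) \<Rightarrow> bool" where
  "gegenbauer_series G T d f a \<longleftrightarrow>
     (\<forall>k. continuous_map T euclidean (a k)) \<and>
     (\<forall>k. positive_definite_on (carrier G) (\<lambda>u v. a k (inv\<^bsub>G\<^esub> u \<otimes>\<^bsub>G\<^esub> v))) \<and>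
     summable (\<lambda>k. a k \<one>\<^bsub>G\<^esub> * of_real (gegenbauer ((real d - 1) / 2) k 1)) \<and>
     (\<forall>u\<in>carrier G. \<forall>t\<in>{-1..1}.
        (\<lambda>k. a k u * of_real (gegenbauer ((real d - 1) / 2) k t)) sums f u t)"

end

theory Submission
  imports Defs
begin

text \<open>For every \<open>k\<close> and \<open>l\<close> the kernel
  \<open>a\<^sub>k b\<^sub>l C\<^sub>k C\<^sub>l\<close> is positive semidefinite, by Schur's
  theorem and the positive definiteness of Gegenbauer polynomials on the sphere. Hence a quadratic
  form of the product kernel vanishes iff all its \<open>(k, l)\<close>-terms vanish; no linearization of
  \<open>C\<^sub>k C\<^sub>l\<close> is needed.

  If all terms vanish at a coefficient family \<open>c\<close> on \<open>U \<times> X\<close> with \<open>X = - X\<close>, then \<open>c\<close> is a null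
  vector of each of these kernels. As \<open>C\<^sub>k(t) C\<^sub>l(t) / (C\<^sub>k(1) C\<^sub>l(1))\<close> tends to 0
  for \<open>\<bar>t\<bar> < 1\<close> as \<open>k + l\<close> grows, the spherical factor becomes diagonally dominant up to
  antipodes, so for every \<open>x\<close> and all large \<open>k + l\<close> of the parity of the sign the vector
  \<open>c(\<cdot>, x) \<plusminus> c(\<cdot>, - x)\<close> is a null vector of \<open>a\<^sub>k b\<^sub>l\<close>. Under the second
  assertion of the theorem it therefore vanishes for both signs.

  Conversely, if only finitely many sums \<open>k + l\<close> of one parity occur, choose \<open>L\<close> of that parity
  beyond them: alternating weights on a regular \<open>2L\<close>-gon in a great circle annihilate
  \<open>C\<^sub>k C\<^sub>l\<close> if \<open>k + l < L\<close> or if \<open>k + l\<close> has the other parity.\<close>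

section \<open>Positive semidefinite kernels\<close>

text \<open>Forms are indexed by finite sets of points instead of enumerations: restriction to
  subsets, extension by zero and product sets then need no renumbering.\<close>

definition herm_form :: "('x \<Rightarrow> 'x \<Rightarrow> complex) \<Rightarrow> 'x set \<Rightarrow> ('x \<Rightarrow> complex) \<Rightarrow> complex" where
  "herm_form K F c = (\<Sum>a\<in>F. \<Sum>b\<in>F. c a * K a b * cnj (c b))"

definition psd_on :: "'x set \<Rightarrow> ('x \<Rightarrow> 'x \<Rightarrow> complex) \<Rightarrow> bool" where
  "psd_on X K \<longleftrightarrow> (\<forall>F c. finite F \<longrightarrow> F \<subseteq> X \<longrightarrow> 0 \<le> herm_form K F c)"

lemma psd_onD: "psd_on X K \<Longrightarrow> finite F \<Longrightarrow> F \<subseteq> X \<Longrightarrow> 0 \<le> herm_form K F c"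
  by (auto simp: psd_on_def)

lemma psd_on_subset: "psd_on X K \<Longrightarrow> Y \<subseteq> X \<Longrightarrow> psd_on Y K"
  by (auto simp: psd_on_def)

lemma herm_form_cong:
  assumes "\<And>a b. a \<in> F \<Longrightarrow> b \<in> F \<Longrightarrow> K a b = L a b" "\<And>a. a \<in> F \<Longrightarrow> c a = e a"
  shows "herm_form K F c = herm_form L F e"
  unfolding herm_form_def using assms by (intro sum.cong) auto

lemma psd_on_cong:
  assumes "\<And>a b. a \<in> X \<Longrightarrow> b \<in> X \<Longrightarrow> K a b = L a b"
  shows "psd_on X K \<longleftrightarrow> psd_on X L"
proof -
  have "herm_form K F c = herm_form L F c" if "F \<subseteq> X" for F c
    using that assms by (intro herm_form_cong) auto
  then show ?thesis by (auto simp: psd_on_def)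
qed

lemma herm_form_image:
  assumes "inj_on f F"
  shows "herm_form K (f ` F) c = herm_form (\<lambda>z w. K (f z) (f w)) F (\<lambda>z. c (f z))"
  unfolding herm_form_def by (simp add: sum.reindex[OF assms])

text \<open>Both sums are grouped by the fibres of \<open>f\<close>: points with a common image pool
  their coefficients. This covers projections and other maps that identify points.\<close>

lemma herm_form_pullback:
  assumes "finite F"
  shows "herm_form (\<lambda>z w. K (f z) (f w)) F c = herm_form K (f ` F) (\<lambda>a. \<Sum>z\<in>{z\<in>F. f z = a}. c z)"
proof -
  have *: "(\<Sum>z\<in>F. h z (f z)) = (\<Sum>a\<in>f ` F. \<Sum>z\<in>{z\<in>F. f z = a}. h z a)" for h :: "'a \<Rightarrow> 'b \<Rightarrow> complex"
    by (subst sum.image_gen[OF assms, of _ f]) (auto intro!: sum.cong)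
  have "herm_form (\<lambda>z w. K (f z) (f w)) F c = (\<Sum>z\<in>F. c z * (\<Sum>w\<in>F. K (f z) (f w) * cnj (c w)))"
    by (simp add: herm_form_def sum_distrib_left mult.assoc)
  also have "\<dots> = (\<Sum>a\<in>f ` F. \<Sum>z\<in>{z\<in>F. f z = a}. c z * (\<Sum>w\<in>F. K a (f w) * cnj (c w)))"
    by (rule *)
  also have "\<dots> = (\<Sum>a\<in>f ` F. \<Sum>z\<in>{z\<in>F. f z = a}. c z * (\<Sum>b\<in>f ` F. \<Sum>w\<in>{w\<in>F. f w = b}. K a b * cnj (c w)))"
    by (subst *) (rule refl)
  also have "\<dots> = herm_form K (f ` F) (\<lambda>a. \<Sum>z\<in>{z\<in>F. f z = a}. c z)"
    unfolding herm_form_def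
    by (simp add: sum_distrib_left[symmetric] sum_distrib_right[symmetric] mult.assoc cnj_sum)
  finally show ?thesis .
qed

lemma psd_on_pullback:
  assumes "psd_on X K" "f ` Z \<subseteq> X"
  shows "psd_on Z (\<lambda>z w. K (f z) (f w))"
  unfolding psd_on_def
proof (intro allI impI)
  fix F c assume "finite F" "F \<subseteq> Z"
  then show "0 \<le> herm_form (\<lambda>z w. K (f z) (f w)) F c"
    using assms by (subst herm_form_pullback) (auto intro!: psd_onD[OF assms(1)])
qed

section \<open>Hermitian symmetry, Gram factorization and null vectors\<close>

lemma nonneg_quadraticD:
  assumes "\<And>s :: complex. 0 \<le> q + cnj s * \<beta> + s * \<gamma> + s * cnj s * \<kappa>"
  shows "\<gamma> = cnj \<beta>" "\<kappa> = 0 \<Longrightarrow> \<beta> = 0"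
proof -
  have q: "Im q = 0" using assms[of 0] by (simp add: less_eq_complex_def)
  \<comment> \<open>The test values 1, -1 and \<open>\<i>\<close> give three real linear equations,
    which together force Hermitian symmetry.\<close>
  have 1: "Im \<beta> + Im \<gamma> + Im \<kappa> = 0" using assms[of 1] q by (simp add: less_eq_complex_def)
  have 2: "- Im \<beta> - Im \<gamma> + Im \<kappa> = 0" using assms[of "-1"] q by (simp add: less_eq_complex_def)
  have 3: "- Re \<beta> + Re \<gamma> + Im \<kappa> = 0" using assms[of \<i>] q by (simp add: less_eq_complex_def)
  show g: "\<gamma> = cnj \<beta>" using 1 2 3 by (simp add: complex_eq_iff)
  assume k: "\<kappa> = 0"
  show "\<beta> = 0"
  proof (rule ccontr)
    assume "\<beta> \<noteq> 0"
    then have n: "(cmod \<beta>)\<^sup>2 > 0" by simp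
    \<comment> \<open>With \<open>\<kappa> = 0\<close>, the value at
      \<open>s = - t * \<beta>\<close> has real part \<open>Re q - 2 * t * (cmod \<beta>)^2\<close>.
      This \<open>t\<close> turns it into \<open>- Re q - 2\<close>, which is negative because
      \<open>q\<close> is itself the value at \<open>s = 0\<close>.\<close>
    define t where "t = (Re q + 1) / (cmod \<beta>)\<^sup>2"
    have "0 \<le> Re (q - 2 * of_real t * (\<beta> * cnj \<beta>))"
      using assms[of "- (of_real t * \<beta>)"] by (simp add: g k less_eq_complex_def algebra_simps)
    also have "\<dots> = Re q - 2 * t * (cmod \<beta>)\<^sup>2"
      by (subst complex_norm_square[symmetric]) simp
    also have "\<dots> = - Re q - 2" using n by (simp add: t_def field_simps)
    finally have "Re q \<le> -2" by simp
    moreover have "Re q \<ge> 0" using assms[of 0] by (simp add: less_eq_complex_def)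
    ultimately show False by simp
  qed
qed

text \<open>The form becomes a quadratic polynomial in the coefficient \<open>s\<close> of one new
  point; this is the shape in which a square can be completed.\<close>

lemma herm_form_insert:
  assumes "finite F" "z \<notin> F"
  shows "herm_form K (insert z F) (c(z := s)) =
    herm_form K F c + cnj s * (\<Sum>a\<in>F. c a * K a z) + s * (\<Sum>b\<in>F. K z b * cnj (c b)) + s * cnj s * K z z"
proof -
  have c: "a \<in> F \<Longrightarrow> (c(z := s)) a = c a" for a using assms by auto
  have "herm_form K (insert z F) (c(z := s)) =
      s * K z z * cnj s + (\<Sum>b\<in>F. s * K z b * cnj (c b)) + (\<Sum>a\<in>F. c a * K a z * cnj s + (\<Sum>b\<in>F. c a * K a b * cnj (c b)))"
    unfolding herm_form_def using assms c by (simp cong: sum.cong)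
  then show ?thesis
    by (simp add: herm_form_def sum.distrib sum_distrib_left algebra_simps)
qed

lemma psd_on_diag: "psd_on X K \<Longrightarrow> z \<in> X \<Longrightarrow> 0 \<le> K z z"
  using psd_onD[of X K "{z}" "\<lambda>_. 1"] by (simp add: herm_form_def)

lemma psd_on_off_diag:
  assumes "psd_on X K" "z \<in> X" "a \<in> X" "a \<noteq> z"
  shows "K z a = cnj (K a z)" "K z z = 0 \<Longrightarrow> K a z = 0"
proof -
  have "0 \<le> K a a + cnj s * K a z + s * K z a + s * cnj s * K z z" for s
    using psd_onD[OF assms(1), of "{z,a}" "(\<lambda>_. 1)(z := s)"] assms
      herm_form_insert[of "{a}" z K "\<lambda>_. 1" s] by (simp add: herm_form_def algebra_simps)
  note nonneg_quadraticD[OF this]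
  then show "K z a = cnj (K a z)" "K z z = 0 \<Longrightarrow> K a z = 0" by blast+
qed

text \<open>Cholesky factorization: one step splits off the Schur complement of a diagonal entry.
  If that entry vanishes then so does its column, and the divisions by zero do no harm.\<close>

lemma psd_on_gram:
  assumes "finite F" "psd_on F K"
  shows "\<exists>gs :: ('x \<Rightarrow> complex) list. \<forall>a\<in>F. \<forall>b\<in>F. K a b = (\<Sum>g\<leftarrow>gs. g a * cnj (g b))"
  using assms
proof (induction F arbitrary: K rule: finite_induct)
  case empty
  then show ?case by simp
next
  case (insert z F)
  define \<kappa> where "\<kappa> = Re (K z z)"
  have k: "K z z = of_real \<kappa>" "\<kappa> \<ge> 0"
    using psd_on_diag[OF insert.prems, of z] by (auto simp: \<kappa>_def less_eq_complex_def complex_eq_iff)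
  have herm: "K z a = cnj (K a z)" if "a \<in> F" for a
    using psd_on_off_diag(1)[OF insert.prems, of z a] that insert.hyps by auto
  have null: "K a z = 0" if "a \<in> F" "\<kappa> = 0" for a
    using psd_on_off_diag(2)[OF insert.prems, of z a] that insert.hyps k by auto
  define L where "L a b = K a b - K a z * K z b / of_real \<kappa>" for a b
  have "psd_on F L"
    unfolding psd_on_def
  proof (intro allI impI)
    fix E c assume E: "finite E" "E \<subseteq> F"
    define \<beta> where "\<beta> = (\<Sum>a\<in>E. c a * K a z)"
    have \<gamma>: "(\<Sum>b\<in>E. K z b * cnj (c b)) = cnj \<beta>"
      using E herm by (auto simp: \<beta>_def cnj_sum mult.commute intro!: sum.cong)
    have "herm_form L E c = herm_form K E c - \<beta> * cnj \<beta> / of_real \<kappa>"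
      unfolding \<gamma>[symmetric] unfolding \<beta>_def herm_form_def L_def
      by (simp add: algebra_simps sum_subtractf sum_product sum_divide_distrib[symmetric])
    \<comment> \<open>This coefficient at \<open>z\<close> completes the square, so the form of
      \<open>L\<close> is a value of the form of \<open>K\<close> on one more point.\<close>
    also have "\<dots> = herm_form K (insert z E) (c(z := - (\<beta> / of_real \<kappa>)))"
      using E insert.hyps
      by (subst herm_form_insert) (auto simp: \<gamma> \<beta>_def[symmetric] k)
    also have "0 \<le> \<dots>"
      using E insert.hyps by (intro psd_onD[OF insert.prems]) auto
    finally show "0 \<le> herm_form L E c" .
  qed
  from insert.IH[OF this] obtain gs
    where gs: "\<And>a b. a \<in> F \<Longrightarrow> b \<in> F \<Longrightarrow> L a b = (\<Sum>g\<leftarrow>gs. g a * cnj (g b))" by blast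
  define h where "h a = K a z / of_real (sqrt \<kappa>)" for a
  have hh: "h a * cnj (h b) = K a z * cnj (K b z) / of_real \<kappa>" for a b
    using k(2) by (simp add: h_def flip: of_real_mult)
  \<comment> \<open>\<open>h\<close> reproduces the row and the column of \<open>z\<close>; the
    earlier functions are set to 0 at \<open>z\<close> so that they do not disturb them.\<close>
  have "K a b = (\<Sum>g\<leftarrow>h # map (\<lambda>g. g(z := 0)) gs. g a * cnj (g b))"
    if "a \<in> insert z F" "b \<in> insert z F" for a b
  proof -
    have 0: "cnj (K z z) = K z z" by (simp add: k)
    have *: "(\<Sum>x\<leftarrow>gs. (if a = z then 0 else x a) * cnj (if b = z then 0 else x b)) =
       (if a = z \<or> b = z then 0 else L a b)"
      using that gs by (auto simp: sum_list_0)
    show ?thesis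
      using that insert.hyps herm null 0 by (auto simp: o_def hh * L_def k)
  qed
  then show ?case by blast
qed

text \<open>A Gram factorization writes the form as a sum of squared moduli of the sums
  \<open>\<Sum>a\<in>F. c a * g a\<close>. These all vanish, and the pairing of \<open>c\<close>
  with the column of \<open>z\<close> is a linear combination of them. The factorization is taken on
  \<open>insert z F\<close> because \<open>z\<close> may lie outside \<open>F\<close>.\<close>

lemma psd_on_null:
  assumes "psd_on X K" "finite F" "F \<subseteq> X" "herm_form K F c = 0" "z \<in> X"
  shows "(\<Sum>a\<in>F. c a * K a z) = 0"
proof -
  obtain gs where gs: "\<And>a b. a \<in> insert z F \<Longrightarrow> b \<in> insert z F \<Longrightarrow> K a b = (\<Sum>g\<leftarrow>gs. g a * cnj (g b))"
    using psd_on_gram[of "insert z F" K] assms psd_on_subset[of X K "insert z F"]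
    by (meson finite_insert insert_subsetI)
  have sw: "(\<Sum>a\<in>F. \<Sum>g\<leftarrow>gs. h a g) = (\<Sum>g\<leftarrow>gs. \<Sum>a\<in>F. h a g)" for h :: "_ \<Rightarrow> _ \<Rightarrow> complex"
    by (induction gs) (auto simp: sum.distrib)
  have re: "(\<Sum>g\<leftarrow>gs. of_real (h g)) = complex_of_real (\<Sum>g\<leftarrow>gs. h g)" for h
    by (induction gs) auto
  have "herm_form K F c = (\<Sum>a\<in>F. \<Sum>b\<in>F. \<Sum>g\<leftarrow>gs. (c a * g a) * cnj (c b * g b))"
    unfolding herm_form_def
    by (intro sum.cong refl) (auto simp: gs sum_list_const_mult[symmetric] sum_list_mult_const[symmetric] algebra_simps)
  also have "\<dots> = (\<Sum>g\<leftarrow>gs. (\<Sum>a\<in>F. c a * g a) * cnj (\<Sum>a\<in>F. c a * g a))"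
    by (simp add: sw sum_product cnj_sum)
  also have "\<dots> = of_real (\<Sum>g\<leftarrow>gs. (cmod (\<Sum>a\<in>F. c a * g a))\<^sup>2)"
    by (simp only: complex_norm_square[symmetric] re)
  finally have "(\<Sum>g\<leftarrow>gs. (cmod (\<Sum>a\<in>F. c a * g a))\<^sup>2) = 0" using assms(4) by simp
  then have 0: "(\<Sum>a\<in>F. c a * g a) = 0" if "g \<in> set gs" for g
    using that by (subst (asm) sum_list_nonneg_eq_0_iff) auto
  have "(\<Sum>a\<in>F. c a * K a z) = (\<Sum>a\<in>F. \<Sum>g\<leftarrow>gs. (c a * g a) * cnj (g z))"
    by (intro sum.cong refl) (auto simp: gs sum_list_const_mult[symmetric] algebra_simps)
  also have "\<dots> = (\<Sum>g\<leftarrow>gs. (\<Sum>a\<in>F. c a * g a) * cnj (g z))"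
    by (simp add: sw sum_distrib_right)
  also have "\<dots> = (\<Sum>g\<leftarrow>gs. 0)"
    by (intro arg_cong[of _ _ sum_list] map_cong refl) (simp add: 0)
  also have "\<dots> = 0" by simp
  finally show ?thesis .
qed

section \<open>Schur products\<close>

lemma psd_on_mult_gram:
  assumes "psd_on X K"
  shows "psd_on X (\<lambda>a b. K a b * (g a * cnj (g b)))"
proof -
  have "herm_form (\<lambda>a b. K a b * (g a * cnj (g b))) F c = herm_form K F (\<lambda>a. c a * g a)" for F c
    by (simp add: herm_form_def algebra_simps)
  then show ?thesis using assms by (auto simp: psd_on_def)
qed

lemma psd_on_add:
  assumes "psd_on X K" "psd_on X L"
  shows "psd_on X (\<lambda>a b. K a b + L a b)"
proof -
  have "herm_form (\<lambda>a b. K a b + L a b) F c = herm_form K F c + herm_form L F c" for F c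
    by (simp add: herm_form_def algebra_simps sum.distrib)
  then show ?thesis using assms by (auto simp: psd_on_def)
qed

lemma psd_on_mult_sum_gram:
  assumes "psd_on X K" 
  shows "psd_on X (\<lambda>a b. K a b * (\<Sum>g\<leftarrow>gs. g a * cnj (g b)))"
proof (induction gs)
  case Nil
  then show ?case by (simp add: psd_on_def herm_form_def)
next
  case (Cons g gs)
  show ?case
    using psd_on_add[OF psd_on_mult_gram[OF assms, of g] Cons] by (simp add: distrib_left)
qed

text \<open>Schur's product theorem: a Gram factorization of \<open>L\<close> reduces it to factors
  \<open>g a * cnj (g b)\<close>, which merely rescale the coefficients.\<close>

lemma psd_on_mult:
  assumes "psd_on X K" "psd_on X L"
  shows "psd_on X (\<lambda>a b. K a b * L a b)"
  unfolding psd_on_def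
proof (intro allI impI)
  fix F c assume F: "finite F" "F \<subseteq> X"
  obtain gs where gs: "\<And>a b. a \<in> F \<Longrightarrow> b \<in> F \<Longrightarrow> L a b = (\<Sum>g\<leftarrow>gs. g a * cnj (g b))"
    using psd_on_gram[of F L] F psd_on_subset[OF assms(2)] by blast
  have "psd_on F (\<lambda>a b. K a b * L a b) \<longleftrightarrow> psd_on F (\<lambda>a b. K a b * (\<Sum>g\<leftarrow>gs. g a * cnj (g b)))"
    by (rule psd_on_cong) (simp add: gs)
  then have "psd_on F (\<lambda>a b. K a b * L a b)"
    using psd_on_mult_sum_gram psd_on_subset[OF assms(1) F(2)] by blast
  then show "0 \<le> herm_form (\<lambda>a b. K a b * L a b) F c"
    using F by (auto simp: psd_on_def)
qed

section \<open>Passage between enumerated and set-indexed forms\<close>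

lemma sesq_form_herm_form:
  assumes "inj_on y {..<n}"
  shows "sesq_form n (\<lambda>i j. K (y i) (y j)) c = herm_form K (y ` {..<n}) (\<lambda>a. c (the_inv_into {..<n} y a))"
  unfolding herm_form_image[OF assms]
  by (simp add: sesq_form_def herm_form_def the_inv_into_f_f[OF assms])

lemma ex_enumeration:
  assumes "finite F"
  obtains n and y :: "nat \<Rightarrow> 'x" where "F = y ` {..<n}" "inj_on y {..<n}" "card F = n"
  using ex_bij_betw_nat_finite[OF assms] unfolding bij_betw_def atLeast0LessThan by metis

lemma positive_definite_on_iff: "positive_definite_on X K \<longleftrightarrow> psd_on X K"
proof
  assume P: "positive_definite_on X K"
  show "psd_on X K" unfolding psd_on_def
  proof (intro allI impI)
    fix F c assume F: "finite F" "F \<subseteq> X"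
    obtain n and y :: "nat \<Rightarrow> 'a" where y: "F = y ` {..<n}" "inj_on y {..<n}" "card F = n"
      by (rule ex_enumeration[OF F(1)])
    show "0 \<le> herm_form K F c"
    \<comment> \<open>Positive definiteness speaks of \<open>n \<ge> 1\<close> only; the empty form
      is 0.\<close>
    proof (cases "n = 0")
      case True
      then show ?thesis using y by (simp add: herm_form_def)
    next
      case False
      then have "0 \<le> sesq_form n (\<lambda>i j. K (y i) (y j)) (\<lambda>i. c (y i))"
        using P[unfolded positive_definite_on_def, rule_format, of n y "\<lambda>i. c (y i)"] y F by simp
      then show ?thesis
        unfolding y(1) herm_form_image[OF y(2)] by (simp add: sesq_form_def herm_form_def)
    qed
  qed
next
  assume "psd_on X K"
  then show "positive_definite_on X K"
    by (simp add: positive_definite_on_def psd_on_def sesq_form_herm_form)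
qed

lemma strictly_positive_definite_on_iff:
  "strictly_positive_definite_on X K \<longleftrightarrow>
    psd_on X K \<and> (\<forall>F c. finite F \<and> F \<subseteq> X \<and> (\<exists>a\<in>F. c a \<noteq> 0) \<longrightarrow> 0 < herm_form K F c)"
proof -
  have "(\<forall>n\<ge>1. \<forall>y c. y ` {..<n} \<subseteq> X \<and> inj_on y {..<n} \<and> (\<exists>i<n. c i \<noteq> 0) \<longrightarrow>
        0 < sesq_form n (\<lambda>i j. K (y i) (y j)) c) \<longleftrightarrow>
     (\<forall>F c. finite F \<and> F \<subseteq> X \<and> (\<exists>a\<in>F. c a \<noteq> 0) \<longrightarrow> 0 < herm_form K F c)" (is "?l \<longleftrightarrow> ?r")
  proof
    assume l: ?l
    show ?r
    proof (intro allI impI, elim conjE bexE)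
      fix F and c :: "_ \<Rightarrow> complex" and a assume F: "finite F" "F \<subseteq> X" "a \<in> F" "c a \<noteq> 0"
      obtain n and y :: "nat \<Rightarrow> 'a" where y: "F = y ` {..<n}" "inj_on y {..<n}" "card F = n"
        by (rule ex_enumeration[OF F(1)])
      have "n \<ge> 1" using F y(3) by (cases n) auto
      then have "0 < sesq_form n (\<lambda>i j. K (y i) (y j)) (\<lambda>i. c (y i))"
        using l[rule_format, of n y "\<lambda>i. c (y i)"] y F by auto
      then show "0 < herm_form K F c"
        unfolding y(1) herm_form_image[OF y(2)] by (simp add: sesq_form_def herm_form_def)
    qed
  next
    assume r: ?r
    show ?l
    proof (intro allI impI, elim conjE exE)
      fix n :: nat and y c and i :: nat assume y: "y ` {..<n} \<subseteq> X" "inj_on y {..<n}" "i < n" "c i \<noteq> (0::complex)"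
      have "c (the_inv_into {..<n} y (y i)) \<noteq> 0" "y i \<in> y ` {..<n}"
        using y by (simp_all add: the_inv_into_f_f[OF y(2)])
      then have "0 < herm_form K (y ` {..<n}) (\<lambda>a. c (the_inv_into {..<n} y a))"
        using y(1) by (intro r[rule_format]) auto
      with y show "0 < sesq_form n (\<lambda>i j. K (y i) (y j)) c"
        by (subst sesq_form_herm_form) auto
    qed
  qed
  then show ?thesis by (simp add: strictly_positive_definite_on_def positive_definite_on_iff)
qed

section \<open>Gegenbauer polynomials\<close>

text \<open>The same recurrence in \<open>real poly\<close> gives access to degrees, leading
  coefficients and formal derivatives.\<close>

fun gegenbauer_poly :: "real \<Rightarrow> nat \<Rightarrow> real poly" where
  "gegenbauer_poly \<alpha> 0 = 1"
| "gegenbauer_poly \<alpha> (Suc 0) = [:0, 2 * \<alpha>:]"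
| "gegenbauer_poly \<alpha> (Suc (Suc k)) =
     smult (1 / (real k + 2))
       (smult (2 * (real k + 1 + \<alpha>)) ([:0, 1:] * gegenbauer_poly \<alpha> (Suc k))
        - smult (real k + 2 * \<alpha>) (gegenbauer_poly \<alpha> k))"

lemma poly_gegenbauer_poly [simp]: "poly (gegenbauer_poly \<alpha> k) t = gegenbauer \<alpha> k t"
  by (induction \<alpha> k t rule: gegenbauer.induct) (simp_all add: algebra_simps add_divide_distrib diff_divide_distrib)

lemma degree_gegenbauer_poly: "degree (gegenbauer_poly \<alpha> k) \<le> k"
proof (induction \<alpha> k rule: gegenbauer_poly.induct)
  case (3 \<alpha> k)
  have "degree ([:0, 1:] * gegenbauer_poly \<alpha> (Suc k)) \<le> Suc (Suc k)"
    using degree_mult_le[of "[:0, 1:]" "gegenbauer_poly \<alpha> (Suc k)"] 3 by simp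
  then show ?case
    using 3 by (auto intro!: degree_diff_le order.trans[OF degree_smult_le] simp del: mult_pCons_left)
qed simp_all

lemma coeff_gegenbauer_poly_pos: "\<alpha> > 0 \<Longrightarrow> coeff (gegenbauer_poly \<alpha> k) k > 0"
proof (induction \<alpha> k rule: gegenbauer_poly.induct)
  case (3 \<alpha> k)
  have "coeff (gegenbauer_poly \<alpha> k) (Suc (Suc k)) = 0"
    using degree_gegenbauer_poly[of \<alpha> k] by (intro coeff_eq_0) simp
  then show ?case using 3 by simp
qed simp_all

text \<open>Subtracting a multiple of the top Gegenbauer polynomial lowers the degree, since its
  leading coefficient is positive. The second conclusion keeps the top coefficient, whose sign
  matters for the kernels on the sphere.\<close>

lemma gegenbauer_poly_expansion:
  assumes "\<alpha> > 0" "degree p \<le> k"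
  obtains b where "p = (\<Sum>j\<le>k. smult (b j) (gegenbauer_poly \<alpha> j))"
    "b k * coeff (gegenbauer_poly \<alpha> k) k = coeff p k"
proof -
  have "\<exists>b. p = (\<Sum>j\<le>k. smult (b j) (gegenbauer_poly \<alpha> j)) \<and>
    b k * coeff (gegenbauer_poly \<alpha> k) k = coeff p k"
    using assms(2)
  proof (induction k arbitrary: p)
    case 0
    then obtain c where "p = [:c:]" by (metis degree_0_id le_zero_eq degree_eq_zeroE)
    then show ?case by (intro exI[of _ "\<lambda>_. c"]) simp
  next
    case (Suc k)
    let ?g = "gegenbauer_poly \<alpha> (Suc k)"
    define s where "s = coeff p (Suc k) / coeff ?g (Suc k)"
    have s: "s * coeff ?g (Suc k) = coeff p (Suc k)"
      using coeff_gegenbauer_poly_pos[OF assms(1), of "Suc k"] by (simp add: s_def)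
    have "degree (p - smult s ?g) \<le> Suc k"
      using Suc.prems degree_gegenbauer_poly[of \<alpha> "Suc k"]
      by (intro degree_diff_le order.trans[OF degree_smult_le])
    moreover have "coeff (p - smult s ?g) (Suc k) = 0" by (simp add: s del: gegenbauer_poly.simps)
    ultimately have "degree (p - smult s ?g) \<le> k"
      by (metis degree_0 eq_zero_or_degree_less leD le_neq_implies_less less_Suc_eq_le zero_le)
    from Suc.IH[OF this] obtain b where
      b: "p - smult s ?g = (\<Sum>j\<le>k. smult (b j) (gegenbauer_poly \<alpha> j))" by blast
    have "p = (\<Sum>j\<le>Suc k. smult ((b(Suc k := s)) j) (gegenbauer_poly \<alpha> j))"
      using b by (simp add: algebra_simps del: gegenbauer_poly.simps)
    with s show ?case by (intro exI[of _ "b(Suc k := s)"]) simp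
  qed
  with that show ?thesis by blast
qed

section \<open>Derivative relations and the Gegenbauer differential equation\<close>

lemma gegenbauer_pderiv:
  "(real k + 1) * gegenbauer \<alpha> (Suc k) t =
     t * poly (pderiv (gegenbauer_poly \<alpha> (Suc k))) t - poly (pderiv (gegenbauer_poly \<alpha> k)) t"
  "poly (pderiv (gegenbauer_poly \<alpha> (Suc k))) t =
     t * poly (pderiv (gegenbauer_poly \<alpha> k)) t + (real k + 2 * \<alpha>) * gegenbauer \<alpha> k t"
\<comment> \<open>The relations are proved together: the step for the second uses the first, and the
  step for the first uses both as well as the new second one.\<close>
proof (induction k)
  case 0
  {
    case 1 show ?case by (simp add: pderiv_pCons)
  next
    case 2 show ?case by (simp add: pderiv_pCons)
  }
next
  case (Suc k)
  define x where "x = real k"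
  define P0 P1 P2 where "P0 = gegenbauer \<alpha> k t" and "P1 = gegenbauer \<alpha> (Suc k) t"
    and "P2 = gegenbauer \<alpha> (Suc (Suc k)) t"
  define Q0 Q1 Q2 where "Q0 = poly (pderiv (gegenbauer_poly \<alpha> k)) t"
    and "Q1 = poly (pderiv (gegenbauer_poly \<alpha> (Suc k))) t"
    and "Q2 = poly (pderiv (gegenbauer_poly \<alpha> (Suc (Suc k)))) t"
  have x: "x + 2 \<noteq> 0" by (simp add: x_def)
  have R: "(x + 2) * P2 = 2 * (x + 1 + \<alpha>) * t * P1 - (x + 2 * \<alpha>) * P0"
    using x by (simp add: P0_def P1_def P2_def x_def)
  have R': "(x + 2) * Q2 = 2 * (x + 1 + \<alpha>) * (P1 + t * Q1) - (x + 2 * \<alpha>) * Q0"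
    using x by (simp add: P0_def P1_def Q0_def Q1_def Q2_def x_def pderiv_smult pderiv_diff
        pderiv_mult pderiv_pCons del: mult_pCons_left)
  have A: "(x + 1) * P1 = t * Q1 - Q0" and B: "Q1 = t * Q0 + (x + 2 * \<alpha>) * P0"
    using Suc by (simp_all add: P0_def P1_def Q0_def Q1_def x_def)
  have "(x + 2) * Q2 = (x + 2) * (t * Q1 + (x + 1 + 2 * \<alpha>) * P1)"
    using A R' by algebra
  then have B': "Q2 = t * Q1 + (x + 1 + 2 * \<alpha>) * P1" using x by simp
  moreover have "(x + 2) * P2 = t * Q2 - Q1"
    using R A B B' by algebra
  moreover have "real (Suc k) = x + 1" by (simp add: x_def)
  ultimately show
    "(real (Suc k) + 1) * gegenbauer \<alpha> (Suc (Suc k)) t =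
       t * poly (pderiv (gegenbauer_poly \<alpha> (Suc (Suc k)))) t - poly (pderiv (gegenbauer_poly \<alpha> (Suc k))) t"
    "poly (pderiv (gegenbauer_poly \<alpha> (Suc (Suc k)))) t =
     t * poly (pderiv (gegenbauer_poly \<alpha> (Suc k))) t + (real (Suc k) + 2 * \<alpha>) * gegenbauer \<alpha> (Suc k) t"
    unfolding P0_def[symmetric] P1_def[symmetric] P2_def[symmetric] Q0_def[symmetric]
      Q1_def[symmetric] Q2_def[symmetric] by (simp_all add: add.commute add.left_commute)
qed

text \<open>Eliminating the derivative of index \<open>k\<close> from the two relations leaves an
  identity whose only derivative is that of index \<open>Suc k\<close>.\<close>

lemma gegenbauer_pderiv_raise:
  "[:1, 0, - 1:] * pderiv (gegenbauer_poly \<alpha> (Suc k)) =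
     smult (real k + 2 * \<alpha>) (gegenbauer_poly \<alpha> k)
     - smult (real k + 1) ([:0, 1:] * gegenbauer_poly \<alpha> (Suc k))" (is "?l = ?r")
proof -
  have "poly ?l t = poly ?r t" for t
  proof -
    define P0 P1 where "P0 = gegenbauer \<alpha> k t" and "P1 = gegenbauer \<alpha> (Suc k) t"
    define Q0 Q1 where "Q0 = poly (pderiv (gegenbauer_poly \<alpha> k)) t"
      and "Q1 = poly (pderiv (gegenbauer_poly \<alpha> (Suc k))) t"
    have "(real k + 1) * P1 = t * Q1 - Q0" "Q1 = t * Q0 + (real k + 2 * \<alpha>) * P0"
      using gegenbauer_pderiv[where k = k and \<alpha> = \<alpha> and t = t] by (simp_all add: P0_def P1_def Q0_def Q1_def)
    then have "(1 - t * t) * Q1 = (real k + 2 * \<alpha>) * P0 - (real k + 1) * (t * P1)" by algebra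
    then show ?thesis
      by (simp add: P0_def P1_def Q1_def algebra_simps del: gegenbauer_poly.simps gegenbauer.simps)
  qed
  then show ?thesis using poly_eq_poly_eq_iff by blast
qed

text \<open>With \<open>\<delta>\<close> one less than the ambient dimension, this is the Laplace
  operator of the unit sphere acting on zonal functions
  \<open>poly p (x \<bullet> y)\<close>.\<close>

definition gegenbauer_op :: "real \<Rightarrow> real poly \<Rightarrow> real poly" where
  "gegenbauer_op \<delta> p = [:1, 0, - 1:] * pderiv (pderiv p) - smult \<delta> ([:0, 1:] * pderiv p)"

lemma poly_gegenbauer_op:
  "poly (gegenbauer_op \<delta> p) t = (1 - t\<^sup>2) * poly (pderiv (pderiv p)) t - \<delta> * t * poly (pderiv p) t"
  by (simp add: gegenbauer_op_def algebra_simps power2_eq_square)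

text \<open>Gegenbauer's differential equation: \<open>gegenbauer_pderiv_raise\<close> is
  differentiated, and the derivative of index \<open>k - 1\<close> is eliminated by the first
  relation of \<open>gegenbauer_pderiv\<close>.\<close>

lemma gegenbauer_op_gegenbauer_poly:
  "gegenbauer_op (2 * \<alpha> + 1) (gegenbauer_poly \<alpha> k) =
     smult (- (real k * (real k + 2 * \<alpha>))) (gegenbauer_poly \<alpha> k)"
proof (cases k)
  case 0
  then show ?thesis by (simp add: gegenbauer_op_def)
next
  case (Suc k')
  have "poly (gegenbauer_op (2 * \<alpha> + 1) (gegenbauer_poly \<alpha> k)) t =
     - (real k * (real k + 2 * \<alpha>)) * gegenbauer \<alpha> k t" for t
  proof -
    define x where "x = real k'"
    define P0 P1 where "P0 = gegenbauer \<alpha> k' t" and "P1 = gegenbauer \<alpha> (Suc k') t"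
    define Q0 Q1 where "Q0 = poly (pderiv (gegenbauer_poly \<alpha> k')) t"
      and "Q1 = poly (pderiv (gegenbauer_poly \<alpha> (Suc k'))) t"
    define R1 where "R1 = poly (pderiv (pderiv (gegenbauer_poly \<alpha> (Suc k')))) t"
    have A: "(x + 1) * P1 = t * Q1 - Q0"
      using gegenbauer_pderiv(1)[where k = k' and \<alpha> = \<alpha> and t = t] by (simp add: x_def P1_def Q0_def Q1_def)
    have "poly (pderiv ([:1, 0, - 1:] * pderiv (gegenbauer_poly \<alpha> (Suc k')))) t =
       poly (pderiv (smult (real k' + 2 * \<alpha>) (gegenbauer_poly \<alpha> k')
     - smult (real k' + 1) ([:0, 1:] * gegenbauer_poly \<alpha> (Suc k')))) t"
      by (simp only: gegenbauer_pderiv_raise)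
    then have "(1 - t * t) * R1 - 2 * t * Q1 = (x + 2 * \<alpha>) * Q0 - (x + 1) * (P1 + t * Q1)"
      by (simp add: P0_def P1_def Q0_def Q1_def R1_def x_def pderiv_mult pderiv_diff pderiv_smult
          pderiv_pCons del: gegenbauer_poly.simps gegenbauer.simps mult_pCons_left)
        (simp add: algebra_simps)
    with A have "(1 - t * t) * R1 - (2 * \<alpha> + 1) * t * Q1 = - ((x + 1) * (x + 1 + 2 * \<alpha>)) * P1"
      by algebra
    then show ?thesis
      unfolding poly_gegenbauer_op Suc P1_def[symmetric] Q1_def[symmetric] R1_def[symmetric]
      by (simp add: x_def power2_eq_square add.commute)
  qed
  then show ?thesis by (simp add: poly_eq_poly_eq_iff[symmetric] fun_eq_iff)
qed

section \<open>Parity, values at 1 and decay inside the interval\<close>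

lemma gegenbauer_minus: "gegenbauer \<alpha> k (- t) = (- 1) ^ k * gegenbauer \<alpha> k t"
  by (induction \<alpha> k t rule: gegenbauer.induct) (simp_all add: algebra_simps)

text \<open>At 1 the three-term recurrence collapses to a two-term one. It yields the positivity of
  the values at 1 and the recurrence for the normalized polynomials.\<close>

lemma gegenbauer_1_Suc:
  "(real k + 1) * gegenbauer \<alpha> (Suc k) 1 = (real k + 2 * \<alpha>) * gegenbauer \<alpha> k 1"
proof (induction k)
  case (Suc k)
  define P0 P1 where "P0 = gegenbauer \<alpha> k 1" and "P1 = gegenbauer \<alpha> (Suc k) 1"
  have "(real k + 1) * P1 = (real k + 2 * \<alpha>) * P0" using Suc by (simp add: P0_def P1_def)
  moreover have "(real k + 2) * gegenbauer \<alpha> (Suc (Suc k)) 1 = 2 * (real k + 1 + \<alpha>) * P1 - (real k + 2 * \<alpha>) * P0"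
    by (simp add: P0_def P1_def)
  ultimately have "(real k + 2) * gegenbauer \<alpha> (Suc (Suc k)) 1 = (real k + 1 + 2 * \<alpha>) * P1" by algebra
  then show ?case unfolding P1_def by (simp add: add.commute add.left_commute)
qed simp

lemma gegenbauer_1_pos: "\<alpha> > 0 \<Longrightarrow> gegenbauer \<alpha> k 1 > 0"
proof (induction k)
  case (Suc k)
  have "(real k + 1) * gegenbauer \<alpha> (Suc k) 1 > 0"
    unfolding gegenbauer_1_Suc using Suc by (intro mult_pos_pos add_nonneg_pos) auto
  then show ?case by (simp add: zero_less_mult_iff)
qed simp

text \<open>The energy \<open>E m = r (m+1)^2 - 2 t r (m+1) r m + (r m)^2\<close> is constant along the
  Chebyshev recurrence; the Gegenbauer recurrence dissipates it at rate at least \<open>1/m\<close>, so by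
  divergence of the harmonic series it tends to zero.\<close>

lemma gegenbauer_quotient_tendsto_0:
  assumes "\<alpha> \<ge> 1 / 2" "\<bar>t\<bar> < 1"
  shows "(\<lambda>m. gegenbauer \<alpha> m t / gegenbauer \<alpha> m 1) \<longlonglongrightarrow> 0"
proof -
  define r where "r m = gegenbauer \<alpha> m t / gegenbauer \<alpha> m 1" for m
  define w where "w m = t * r (Suc m) - r m" for m
  \<comment> \<open>Normalized at 1, the recurrence becomes
    \<open>r (Suc (Suc m)) = t * r (Suc m) + \<rho> m * w m\<close>. The Chebyshev recurrence is the
    case \<open>\<rho> m = 1\<close>, so \<open>\<rho>\<close> measures the damping.\<close>
  define \<rho> where "\<rho> m = (real m + 1) / (real m + 1 + 2 * \<alpha>)" for m
  \<comment> \<open>This is the energy with the square completed: one step multiplies the summand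
    \<open>(w m)^2\<close> by \<open>(\<rho> m)^2\<close> and keeps the value of the other
    summand.\<close>
  define E where "E m = (1 - t\<^sup>2) * (r (Suc m))\<^sup>2 + (w m)\<^sup>2" for m
  have t: "0 < 1 - t\<^sup>2" "1 - t\<^sup>2 \<le> 1" using assms(2) by (simp_all add: abs_square_less_1)
  have \<rho>: "0 \<le> \<rho> m" "\<rho> m \<le> 1" "1 - (\<rho> m)\<^sup>2 \<ge> 1 / (real m + 2)" for m
  proof -
    show 1: "0 \<le> \<rho> m" "\<rho> m \<le> 1" using assms by (auto simp: \<rho>_def field_simps)
    have "(real m + 1) * 1 \<le> (real m + 1) * (2 * \<alpha>)" using assms by (intro mult_left_mono) auto
    then have "1 / (real m + 2) \<le> 1 - \<rho> m" using assms by (simp add: \<rho>_def field_simps)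
    also have "\<dots> \<le> 1 - (\<rho> m)\<^sup>2" using 1 by (simp add: power2_eq_square mult_left_le)
    finally show "1 - (\<rho> m)\<^sup>2 \<ge> 1 / (real m + 2)" .
  qed
  have rec: "r (Suc (Suc m)) = t * r (Suc m) + \<rho> m * w m" for m
  proof -
    define x where "x = real m"
    define P0 P1 P2 where "P0 = gegenbauer \<alpha> m t" and "P1 = gegenbauer \<alpha> (Suc m) t"
      and "P2 = gegenbauer \<alpha> (Suc (Suc m)) t"
    define e0 e1 e2 where "e0 = gegenbauer \<alpha> m 1" and "e1 = gegenbauer \<alpha> (Suc m) 1"
      and "e2 = gegenbauer \<alpha> (Suc (Suc m)) 1"
    have pos: "e0 > 0" "e1 > 0" "e2 > 0" "x + 2 > 0" "x + 1 > 0" "x + 1 + 2 * \<alpha> > 0"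
      using assms gegenbauer_1_pos[of \<alpha>] by (auto simp: e0_def e1_def e2_def x_def simp del: gegenbauer.simps)
    have R: "(x + 2) * P2 = 2 * (x + 1 + \<alpha>) * t * P1 - (x + 2 * \<alpha>) * P0"
      by (simp add: P0_def P1_def P2_def x_def)
    have e1: "(x + 1) * e1 = (x + 2 * \<alpha>) * e0"
      unfolding e0_def e1_def x_def by (rule gegenbauer_1_Suc)
    have e2: "(x + 2) * e2 = (x + 1 + 2 * \<alpha>) * e1"
      using gegenbauer_1_Suc[of "Suc m" \<alpha>] unfolding e2_def e1_def x_def
      by (simp add: add.commute add.left_commute del: gegenbauer.simps)
    have "r (Suc (Suc m)) = ((x + 2) * P2) / ((x + 2) * e2)"
      using pos by (simp add: r_def P2_def e2_def del: gegenbauer.simps)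
    also have "\<dots> = (2 * (x + 1 + \<alpha>) * t * (P1 / e1) - (x + 2 * \<alpha>) * P0 / e1) / (x + 1 + 2 * \<alpha>)"
      unfolding R e2 by (simp add: diff_divide_distrib mult.commute)
    also have "(x + 2 * \<alpha>) * P0 / e1 = (x + 1) * (P0 / e0)"
    proof -
      have "(x + 2 * \<alpha>) * P0 * e0 = (x + 1) * P0 * e1" using e1 by algebra
      then show ?thesis using pos by (simp add: frac_eq_eq)
    qed
    also have "(2 * (x + 1 + \<alpha>) * t * (P1 / e1) - (x + 1) * (P0 / e0)) / (x + 1 + 2 * \<alpha>) =
       t * (P1 / e1) + (x + 1) / (x + 1 + 2 * \<alpha>) * (t * (P1 / e1) - P0 / e0)"
    proof -
      have *: "(2 * (x + 1 + \<alpha>) * t * u - (x + 1) * v) / (x + 1 + 2 * \<alpha>) =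
       t * u + (x + 1) / (x + 1 + 2 * \<alpha>) * (t * u - v)" for u v
        using pos(6) by (simp add: divide_simps) (simp add: algebra_simps)
      show ?thesis by (rule *)
    qed
    finally show ?thesis
      by (simp add: r_def w_def \<rho>_def P0_def P1_def e0_def e1_def x_def del: gegenbauer.simps)
  qed
  have E_Suc: "E (Suc m) = E m - (1 - (\<rho> m)\<^sup>2) * (w m)\<^sup>2" for m
  proof -
    have "E (Suc m) = (r (Suc (Suc m)) - t * r (Suc m))\<^sup>2 + (1 - t\<^sup>2) * (r (Suc m))\<^sup>2"
      by (simp add: E_def w_def power2_eq_square algebra_simps)
    also have "\<dots> = (\<rho> m * w m)\<^sup>2 + (1 - t\<^sup>2) * (r (Suc m))\<^sup>2" by (simp add: rec)
    also have "\<dots> = E m - (1 - (\<rho> m)\<^sup>2) * (w m)\<^sup>2"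
      by (simp add: E_def power_mult_distrib algebra_simps)
    finally show ?thesis .
  qed
  have E_nonneg: "0 \<le> E m" for m using t by (simp add: E_def)
  have drop: "E m - E (Suc m) \<ge> (w m)\<^sup>2 / (real m + 2)" for m
    using mult_right_mono[OF \<rho>(3)[of m], of "(w m)\<^sup>2"] by (simp add: E_Suc)
  then have "E (Suc m) \<le> E m" for m
    by (smt (verit) divide_nonneg_nonneg of_nat_0_le_iff zero_le_power2)
  then have dec: "decseq E" by (rule decseq_SucI)
  obtain e where e: "E \<longlonglongrightarrow> e" "\<And>m. e \<le> E m"
    using decseq_convergent[OF dec, of 0] E_nonneg by blast
  have "e \<ge> 0" using e(1) E_nonneg by (intro LIMSEQ_le_const) auto
  have "e = 0"
  proof (rule ccontr)
    assume "e \<noteq> 0"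
    with \<open>e \<ge> 0\<close> have "e > 0" by simp
    define q where "q = (1 - t\<^sup>2) * e / 3"
    have "q > 0" using t \<open>e > 0\<close> by (simp add: q_def)
    \<comment> \<open>A single \<open>w m\<close> may be small while the energy is not, but
      \<open>w m\<close> and \<open>w (Suc m)\<close> together bound \<open>E m\<close> from above.
      Hence two consecutive steps lose at least \<open>q / (m + 3)\<close>, and the sums
      \<open>E m + E (Suc m)\<close> telescope.\<close>
    have lower: "q * (1 / (real m + 3)) \<le> (E m + E (Suc m)) - (E (Suc m) + E (Suc (Suc m)))" for m
    proof -
      define W where "W = (w m)\<^sup>2 + (w (Suc m))\<^sup>2"
      have eq: "(1 - t\<^sup>2) * r (Suc m) = t * \<rho> m * w m - w (Suc m)"
        by (simp add: w_def[of "Suc m"] rec algebra_simps power2_eq_square)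
      have "(1 - t\<^sup>2) * ((1 - t\<^sup>2) * (r (Suc m))\<^sup>2) = (t * \<rho> m * w m - w (Suc m))\<^sup>2"
        unfolding eq[symmetric] by (simp add: power2_eq_square)
      also have "\<dots> \<le> 2 * (t * \<rho> m * w m)\<^sup>2 + 2 * (w (Suc m))\<^sup>2"
        using zero_le_power2[of "t * \<rho> m * w m + w (Suc m)"]
        unfolding power2_sum power2_diff by linarith
      also have "(t * \<rho> m * w m)\<^sup>2 \<le> (w m)\<^sup>2"
      proof -
        have "\<bar>t * \<rho> m\<bar> \<le> 1"
          using \<rho>[of m] assms(2) by (simp add: abs_mult mult_le_one)
        then have "(t * \<rho> m)\<^sup>2 \<le> 1" by (simp add: abs_square_le_1)
        then show ?thesis by (simp add: power_mult_distrib mult_left_le_one_le)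
      qed
      finally have 1: "(1 - t\<^sup>2) * ((1 - t\<^sup>2) * (r (Suc m))\<^sup>2) \<le> 2 * W" by (simp add: W_def)
      have 2: "(1 - t\<^sup>2) * (w m)\<^sup>2 \<le> W"
        using t by (simp add: W_def mult_left_le_one_le add_increasing2)
      have "(1 - t\<^sup>2) * e \<le> (1 - t\<^sup>2) * E m" using e(2) t by (intro mult_left_mono) auto
      also have "\<dots> \<le> 3 * W" using 1 2 by (simp add: E_def distrib_left)
      finally have "q \<le> W" by (simp add: q_def)
      then have "q / (real m + 3) \<le> W / (real m + 3)" by (intro divide_right_mono) auto
      also have "\<dots> \<le> (w m)\<^sup>2 / (real m + 2) + (w (Suc m))\<^sup>2 / (real (Suc m) + 2)"
        unfolding W_def add_divide_distrib
        by (rule add_mono; rule frac_le) auto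
      also have "\<dots> \<le> (E m - E (Suc m)) + (E (Suc m) - E (Suc (Suc m)))"
        by (intro add_mono drop)
      finally show ?thesis by simp
    qed
    have "(\<lambda>m. E (Suc m)) \<longlonglongrightarrow> e" using e(1) by (rule LIMSEQ_Suc)
    with e(1) have "(\<lambda>m. E m + E (Suc m)) \<longlonglongrightarrow> e + e"
      by (rule tendsto_add)
    then have "summable (\<lambda>m. (E m + E (Suc m)) - (E (Suc m) + E (Suc (Suc m))))"
      by (rule telescope_summable')
    then have "summable (\<lambda>m. q * (1 / (real m + 3)))"
      by (rule summable_comparison_test') (use lower \<open>q > 0\<close> in auto)
    then have "summable (\<lambda>m. 1 / (real m + 3))"
      using \<open>q > 0\<close> by (simp add: summable_cmult_iff del: times_divide_eq_right)
    then have "summable (\<lambda>m. inverse (real (m + 3)))"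
      by (simp add: inverse_eq_divide)
    then have "summable (\<lambda>m. inverse (real m))"
      using summable_iff_shift[of "\<lambda>m. inverse (real m)" 3] by blast
    with not_summable_harmonic show False by blast
  qed
  then have "(\<lambda>m. E m / (1 - t\<^sup>2)) \<longlonglongrightarrow> 0"
    using e(1) tendsto_divide[of E 0 sequentially "\<lambda>_. 1 - t\<^sup>2" "1 - t\<^sup>2"] t by simp
  moreover have "(r (Suc m))\<^sup>2 \<le> E m / (1 - t\<^sup>2)" for m
  proof -
    have "(r (Suc m))\<^sup>2 * (1 - t\<^sup>2) \<le> E m" by (simp add: E_def mult.commute)
    then show ?thesis by (simp only: pos_le_divide_eq[OF t(1)])
  qed
  ultimately have "(\<lambda>m. (r (Suc m))\<^sup>2) \<longlonglongrightarrow> 0"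
    by - (rule Lim_null_comparison[where g = "\<lambda>m. E m / (1 - t\<^sup>2)"], auto)
  then have "(\<lambda>m. sqrt ((r (Suc m))\<^sup>2)) \<longlonglongrightarrow> sqrt 0" by (rule tendsto_real_sqrt)
  then have "(\<lambda>m. r (Suc m)) \<longlonglongrightarrow> 0" by (simp add: tendsto_rabs_zero_iff)
  then have "r \<longlonglongrightarrow> 0" by (simp add: filterlim_sequentially_Suc)
  then show ?thesis by (simp add: r_def[abs_def])
qed

section \<open>Positive definiteness on the sphere\<close>

text \<open>For orthonormal \<open>a\<close> and \<open>b\<close> this is the velocity field of the
  rotation in their plane, which takes \<open>a\<close> towards \<open>b\<close>.\<close>

definition rot_field :: "'b::euclidean_space \<Rightarrow> 'b \<Rightarrow> 'b \<Rightarrow> 'b" where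
  "rot_field a b x = (x \<bullet> a) *\<^sub>R b - (x \<bullet> b) *\<^sub>R a"

lemma inner_rot_field: "rot_field a b x \<bullet> y = (x \<bullet> a) * (y \<bullet> b) - (x \<bullet> b) * (y \<bullet> a)"
  by (simp add: rot_field_def inner_diff_left inner_commute[of a y] inner_commute[of b y])

lemma rot_field_orthogonal: "x \<bullet> rot_field a b x = 0"
  by (simp add: rot_field_def inner_diff_right)

lemma bounded_linear_rot_field: "bounded_linear (rot_field a b)"
  unfolding rot_field_def by (intro bounded_linear_intros)

text \<open>Lagrange's identity; the factor 2 arises because the sum runs over ordered pairs of
  coordinates.\<close>

lemma sum_rot_field_sq:
  fixes x y :: "'b::euclidean_space"
  shows "(\<Sum>a\<in>Basis. \<Sum>b\<in>Basis. (rot_field a b x \<bullet> y)\<^sup>2) = 2 * ((x \<bullet> x) * (y \<bullet> y) - (x \<bullet> y)\<^sup>2)"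
proof -
  have "(\<Sum>a\<in>Basis. \<Sum>b\<in>Basis. (rot_field a b x \<bullet> y)\<^sup>2) =
    (\<Sum>a\<in>Basis. \<Sum>b\<in>Basis. (x \<bullet> a * (x \<bullet> a)) * (y \<bullet> b * (y \<bullet> b)) + (y \<bullet> a * (y \<bullet> a)) * (x \<bullet> b * (x \<bullet> b))
       - 2 * ((x \<bullet> a * (y \<bullet> a)) * (x \<bullet> b * (y \<bullet> b))))"
    by (intro sum.cong refl) (simp add: inner_rot_field power2_eq_square algebra_simps)
  also have "\<dots> = 2 * ((x \<bullet> x) * (y \<bullet> y) - (x \<bullet> y)\<^sup>2)"
    by (simp add: sum.distrib sum_subtractf sum_distrib_left[symmetric] sum_distrib_right[symmetric]
        euclidean_inner[symmetric] power2_eq_square)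
  finally show ?thesis .
qed

text \<open>For distinct \<open>a\<close> and \<open>b\<close> the square of the rotation generator
  is minus the projection onto their plane. In dimension n each coordinate axis belongs to 2 (n - 1)
  ordered pairs.\<close>

lemma sum_rot_field_rot_field:
  fixes x y :: "'b::euclidean_space"
  shows "(\<Sum>a\<in>Basis. \<Sum>b\<in>Basis. rot_field a b (rot_field a b x) \<bullet> y) = - 2 * (real DIM('b) - 1) * (x \<bullet> y)"
proof -
  have "(\<Sum>a\<in>Basis. \<Sum>b\<in>Basis. rot_field a b (rot_field a b x) \<bullet> y) =
    (\<Sum>a\<in>Basis. \<Sum>b\<in>Basis. (if a = b then 2 * (x \<bullet> b * (y \<bullet> b)) else 0) - x \<bullet> b * (y \<bullet> b) - x \<bullet> a * (y \<bullet> a))"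
    by (intro sum.cong refl)
      (auto simp: inner_rot_field[of _ _ "rot_field _ _ _"] inner_rot_field[of _ _ x] inner_Basis algebra_simps)
  also have "\<dots> = 2 * (x \<bullet> y) - real DIM('b) * (x \<bullet> y) - real DIM('b) * (x \<bullet> y)"
    by (simp add: sum_subtractf sum_distrib_left[symmetric] euclidean_inner[symmetric])
  finally show ?thesis by (simp add: algebra_simps)
qed

section \<open>Differentiation of identities on the sphere\<close>

lemma has_derivative_tangent_sphere_zero:
  fixes F :: "'b::euclidean_space \<Rightarrow> real"
  assumes F: "(F has_derivative F') (at x)" and x: "x \<in> sphere 0 1" and v: "x \<bullet> v = 0"
    and 0: "\<And>z. z \<in> sphere 0 1 \<Longrightarrow> F z = 0"
  shows "F' v = 0"
proof -
  \<comment> \<open>\<open>\<gamma>\<close> is the line through \<open>x\<close> in direction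
    \<open>v\<close>, normalized to stay on the sphere. As \<open>v\<close> is orthogonal to
    \<open>x\<close>, the factor \<open>s\<close> has derivative 0 at 0, so the velocity of
    \<open>\<gamma>\<close> there is \<open>v\<close>.\<close>
  define s where "s h = 1 / sqrt (1 + h\<^sup>2 * (v \<bullet> v))" for h
  define \<gamma> where "\<gamma> h = s h *\<^sub>R (x + h *\<^sub>R v)" for h
  have pos: "1 + h\<^sup>2 * (v \<bullet> v) > 0" for h by (simp add: add_pos_nonneg)
  have "norm (x + h *\<^sub>R v) = sqrt (1 + h\<^sup>2 * (v \<bullet> v))" for h
    using x v by (simp add: norm_eq_sqrt_inner inner_add_left inner_add_right inner_commute power2_eq_square)
  then have "\<gamma> h \<in> sphere 0 1" for h
    using pos[of h] by (simp add: \<gamma>_def s_def)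
  then have F0: "F (\<gamma> h) = 0" for h by (rule 0)
  have "(s has_real_derivative 0) (at 0)"
    unfolding s_def by (auto intro!: derivative_eq_intros)
  then have "(\<gamma> has_vector_derivative v) (at 0)"
    unfolding \<gamma>_def by (auto intro!: derivative_eq_intros simp: s_def has_real_derivative_iff_has_vector_derivative)
  then have "(\<gamma> has_derivative (\<lambda>h. h *\<^sub>R v)) (at 0)" by (simp add: has_vector_derivative_def)
  moreover have "\<gamma> 0 = x" by (simp add: \<gamma>_def s_def)
  ultimately have "((\<lambda>h. F (\<gamma> h)) has_derivative (\<lambda>h. F' (h *\<^sub>R v))) (at 0)"
    using F by (intro has_derivative_compose[of \<gamma> _ 0 UNIV F F']) auto
  then have "((\<lambda>h::real. 0::real) has_derivative (\<lambda>h. F' (h *\<^sub>R v))) (at 0)" by (simp add: F0)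
  then have "(\<lambda>h. F' (h *\<^sub>R v)) = (\<lambda>h. 0)"
    by (rule has_derivative_unique) simp
  then show ?thesis by (metis scaleR_one)
qed

definition rot_deriv :: "'b \<Rightarrow> 'b \<Rightarrow> ('b::euclidean_space \<Rightarrow> real) \<Rightarrow> 'b \<Rightarrow> real" where
  "rot_deriv a b \<phi> x = frechet_derivative \<phi> (at x) (rot_field a b x)"

text \<open>Polynomial functions are differentiable and closed under rotation derivatives, so these
  derivatives can be iterated freely.\<close>

lemma real_polynomial_function_rot_deriv:
  fixes \<phi> :: "'b::euclidean_space \<Rightarrow> real"
  assumes "real_polynomial_function \<phi>"
  shows "(\<forall>x. \<phi> differentiable (at x)) \<and> real_polynomial_function (rot_deriv a b \<phi>)"
  using assms
proof (induction rule: real_polynomial_function.induct)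
  case (linear f)
  have "rot_deriv a b f = f \<circ> rot_field a b"
    by (simp add: fun_eq_iff rot_deriv_def frechet_derivative_at[OF bounded_linear_imp_has_derivative[OF linear], symmetric])
  moreover have "bounded_linear (f \<circ> rot_field a b)"
    unfolding o_def by (rule bounded_linear_compose[OF linear bounded_linear_rot_field])
  ultimately show ?case
    using linear bounded_linear_imp_differentiable real_polynomial_function.intros(1) by metis
next
  case (const c)
  have "rot_deriv a b (\<lambda>x. c) = (\<lambda>x. 0)"
    by (simp add: fun_eq_iff rot_deriv_def)
  then show ?case by (simp add: real_polynomial_function.intros(2))
next
  case (add f g)
  then have "((\<lambda>x. f x + g x) has_derivative (\<lambda>v. frechet_derivative f (at x) v + frechet_derivative g (at x) v)) (at x)" for x
    by (intro has_derivative_add) (auto simp: frechet_derivative_works)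
  note frechet_derivative_at[OF this, symmetric]
  then have "rot_deriv a b (\<lambda>x. f x + g x) = (\<lambda>x. rot_deriv a b f x + rot_deriv a b g x)"
    by (simp add: fun_eq_iff rot_deriv_def)
  then show ?case using add by auto
next
  case (mult f g)
  then have "((\<lambda>x. f x * g x) has_derivative
      (\<lambda>v. f x * frechet_derivative g (at x) v + frechet_derivative f (at x) v * g x)) (at x)" for x
    by (intro has_derivative_mult) (auto simp: frechet_derivative_works)
  note frechet_derivative_at[OF this, symmetric]
  then have "rot_deriv a b (\<lambda>x. f x * g x) = (\<lambda>x. f x * rot_deriv a b g x + rot_deriv a b f x * g x)"
    by (simp add: fun_eq_iff rot_deriv_def)
  then show ?case using mult by auto
qed

text \<open>For \<open>\<mu> = 0\<close> this is the Laplace operator of the sphere, written as a sum of squares of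
  rotation fields; each coordinate plane occurs twice, whence the factor \<open>1 / 2\<close>.\<close>

definition sphere_op :: "real \<Rightarrow> ('b::euclidean_space \<Rightarrow> real) \<Rightarrow> 'b \<Rightarrow> real" where
  "sphere_op \<mu> \<phi> x = 1 / 2 * (\<Sum>a\<in>Basis. \<Sum>b\<in>Basis. rot_deriv a b (rot_deriv a b \<phi>) x) + \<mu> * \<phi> x"

lemma real_polynomial_function_sphere_op:
  "real_polynomial_function \<phi> \<Longrightarrow> real_polynomial_function (sphere_op \<mu> \<phi>)"
  unfolding sphere_op_def
  by (intro real_polynomial_function.intros(2-4) real_polynomial_function_sum finite_Basis
      real_polynomial_function_rot_deriv[THEN conjunct2])

text \<open>The difference of the two sides vanishes on the sphere, and rotation fields are tangent
  to it. The identity may therefore be differentiated along them although it can fail off the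
  sphere.\<close>

lemma rot_deriv_sphere_eq:
  fixes \<phi> :: "'i \<Rightarrow> 'b::euclidean_space \<Rightarrow> real"
  assumes "finite I" "\<And>i. i \<in> I \<Longrightarrow> real_polynomial_function (\<phi> i)"
    and g: "(g has_derivative g') (at x)" and x: "x \<in> sphere 0 1"
    and eq: "\<And>z. z \<in> sphere 0 1 \<Longrightarrow> g z = (\<Sum>i\<in>I. \<phi> i z * e i)"
  shows "g' (rot_field a b x) = (\<Sum>i\<in>I. rot_deriv a b (\<phi> i) x * e i)"
proof -
  have "((\<lambda>z. g z - (\<Sum>i\<in>I. \<phi> i z * e i)) has_derivative
      (\<lambda>v. g' v - (\<Sum>i\<in>I. frechet_derivative (\<phi> i) (at x) v * e i))) (at x)"
    using assms(2) real_polynomial_function_rot_deriv frechet_derivative_works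
    by (intro has_derivative_diff g has_derivative_sum has_derivative_mult_left) blast
  from has_derivative_tangent_sphere_zero[OF this x rot_field_orthogonal] eq
  show ?thesis by (simp add: rot_deriv_def)
qed

lemma has_derivative_poly_inner:
  "((\<lambda>z. poly p (z \<bullet> y)) has_derivative (\<lambda>v. poly (pderiv p) (x \<bullet> y) * (v \<bullet> y))) (at x)"
proof -
  have "(poly p has_derivative (\<lambda>h. h * poly (pderiv p) (x \<bullet> y))) (at (x \<bullet> y))"
    using poly_DERIV[of p "x \<bullet> y"] by (simp add: has_field_derivative_def mult_commute_abs)
  moreover have "((\<lambda>z. z \<bullet> y) has_derivative (\<lambda>v. v \<bullet> y)) (at x)"
    by (auto intro!: derivative_eq_intros)
  ultimately have "((\<lambda>z. poly p (z \<bullet> y)) has_derivative (\<lambda>v. (v \<bullet> y) * poly (pderiv p) (x \<bullet> y))) (at x)"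
    by (intro has_derivative_compose[of "\<lambda>z. z \<bullet> y" _ x UNIV "poly p"]) auto
  then show ?thesis by (simp add: mult.commute)
qed

text \<open>The operator is applied to the identity in the variable \<open>x\<close>. On the right
  it acts on each \<open>\<phi> i\<close>; on the left the chain rule and the two sums over
  coordinate planes produce the Gegenbauer operator.\<close>

lemma sphere_op_zonal:
  fixes \<phi> :: "'i \<Rightarrow> 'b::euclidean_space \<Rightarrow> real"
  assumes I: "finite I" "\<And>i. i \<in> I \<Longrightarrow> real_polynomial_function (\<phi> i)"
    and y: "y \<in> sphere 0 1" and x: "x \<in> sphere 0 1"
    and eq: "\<And>z. z \<in> sphere 0 1 \<Longrightarrow> poly p (z \<bullet> y) = (\<Sum>i\<in>I. \<phi> i z * e i)"
  shows "poly (gegenbauer_op (real DIM('b) - 1) p + smult \<mu> p) (x \<bullet> y) = (\<Sum>i\<in>I. sphere_op \<mu> (\<phi> i) x * e i)"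
proof -
  let ?p1 = "poly (pderiv p)" and ?p2 = "poly (pderiv (pderiv p))"
  have xy: "x \<bullet> x = 1" "y \<bullet> y = 1" using x y by (simp_all add: norm_eq_1)
  have 1: "?p1 (z \<bullet> y) * (rot_field a b z \<bullet> y) = (\<Sum>i\<in>I. rot_deriv a b (\<phi> i) z * e i)"
    if "z \<in> sphere 0 1" for a b z
    by (rule rot_deriv_sphere_eq[OF I has_derivative_poly_inner that eq])
  have 2: "?p2 (x \<bullet> y) * (rot_field a b x \<bullet> y)\<^sup>2 + ?p1 (x \<bullet> y) * (rot_field a b (rot_field a b x) \<bullet> y) =
      (\<Sum>i\<in>I. rot_deriv a b (rot_deriv a b (\<phi> i)) x * e i)" for a b
  proof -
    have "((\<lambda>z. rot_field a b z \<bullet> y) has_derivative (\<lambda>v. rot_field a b v \<bullet> y)) (at x)"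
      by (intro bounded_linear_imp_has_derivative bounded_linear_inner_left_comp bounded_linear_rot_field)
    then have "((\<lambda>z. ?p1 (z \<bullet> y) * (rot_field a b z \<bullet> y)) has_derivative
       (\<lambda>v. ?p1 (x \<bullet> y) * (rot_field a b v \<bullet> y) + ?p2 (x \<bullet> y) * (v \<bullet> y) * (rot_field a b x \<bullet> y))) (at x)"
      by (rule has_derivative_mult[OF has_derivative_poly_inner])
    from rot_deriv_sphere_eq[OF I(1) _ this x 1, of a b] I(2) real_polynomial_function_rot_deriv
    have "?p1 (x \<bullet> y) * (rot_field a b (rot_field a b x) \<bullet> y) +
        ?p2 (x \<bullet> y) * (rot_field a b x \<bullet> y) * (rot_field a b x \<bullet> y) =
        (\<Sum>i\<in>I. rot_deriv a b (rot_deriv a b (\<phi> i)) x * e i)" by blast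
    then show ?thesis by (simp add: power2_eq_square algebra_simps)
  qed
  have "(\<Sum>i\<in>I. sphere_op \<mu> (\<phi> i) x * e i) =
     1 / 2 * (\<Sum>i\<in>I. (\<Sum>a\<in>Basis. \<Sum>b\<in>Basis. rot_deriv a b (rot_deriv a b (\<phi> i)) x * e i)) + \<mu> * (\<Sum>i\<in>I. \<phi> i x * e i)"
    by (simp add: sphere_op_def distrib_right sum.distrib sum_distrib_left sum_distrib_right mult.assoc)
  also have "(\<Sum>i\<in>I. (\<Sum>a\<in>Basis. \<Sum>b\<in>Basis. rot_deriv a b (rot_deriv a b (\<phi> i)) x * e i)) =
     (\<Sum>a\<in>Basis. \<Sum>b\<in>Basis. \<Sum>i\<in>I. rot_deriv a b (rot_deriv a b (\<phi> i)) x * e i)"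
    by (subst sum.swap) (intro sum.cong refl sum.swap)
  also have "\<dots> = ?p2 (x \<bullet> y) * (\<Sum>a\<in>Basis. \<Sum>b\<in>Basis. (rot_field a b x \<bullet> y)\<^sup>2) +
      ?p1 (x \<bullet> y) * (\<Sum>a\<in>Basis. \<Sum>b\<in>Basis. rot_field a b (rot_field a b x) \<bullet> y)"
    by (simp add: 2[symmetric] sum.distrib sum_distrib_left)
  finally show ?thesis
    unfolding sum_rot_field_sq sum_rot_field_rot_field eq[OF x, symmetric]
    by (simp add: poly_gegenbauer_op xy algebra_simps)
qed

section \<open>Polynomial Gram representations of Gegenbauer kernels\<close>

definition sphere_gram :: "'b::euclidean_space itself \<Rightarrow> real poly \<Rightarrow> bool" where
  "sphere_gram _ p \<longleftrightarrow> (\<exists>(N :: nat) \<phi>. (\<forall>i<N. real_polynomial_function (\<phi> i)) \<and>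
     (\<forall>x\<in>sphere (0::'b) 1. \<forall>y\<in>sphere 0 1. poly p (x \<bullet> y) = (\<Sum>i<N. \<phi> i x * \<phi> i y)))"

lemma sphere_gramI:
  fixes \<phi> :: "'i \<Rightarrow> 'b::euclidean_space \<Rightarrow> real"
  assumes "finite I" "\<And>i. i \<in> I \<Longrightarrow> real_polynomial_function (\<phi> i)"
    and "\<And>x y. x \<in> sphere 0 1 \<Longrightarrow> y \<in> sphere 0 1 \<Longrightarrow> poly p (x \<bullet> y) = (\<Sum>i\<in>I. \<phi> i x * \<phi> i y)"
  shows "sphere_gram TYPE('b) p"
proof -
  obtain n and h :: "nat \<Rightarrow> 'i" where h: "I = h ` {..<n}" "inj_on h {..<n}"
    using ex_enumeration[OF assms(1)] by metis
  show ?thesis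
    unfolding sphere_gram_def
    by (rule exI[of _ n], rule exI[of _ "\<lambda>i. \<phi> (h i)"])
      (use assms(2,3) h in \<open>auto simp: sum.reindex\<close>)
qed

text \<open>Multiplying the kernel by the inner product multiplies the factors by the coordinate
  functions.\<close>

lemma sphere_gram_power: "sphere_gram TYPE('b::euclidean_space) ([:0, 1:] ^ k)"
proof (induction k)
  case 0
  show ?case
    by (rule sphere_gramI[of "{()}" "\<lambda>_ _. 1"]) (auto intro: real_polynomial_function.intros(2))
next
  case (Suc k)
  from Suc obtain N :: nat and \<phi> where N[rule_format]: "\<forall>i<N. real_polynomial_function (\<phi> i :: 'b \<Rightarrow> real)"
    and eq[rule_format]: "\<forall>x\<in>sphere 0 1. \<forall>y\<in>sphere 0 1.
      poly ([:0, 1:] ^ k) (x \<bullet> y) = (\<Sum>i<N. \<phi> i x * \<phi> i y)"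
    unfolding sphere_gram_def by blast
  show ?case
  proof (rule sphere_gramI[of "Basis \<times> {..<N}" "\<lambda>(b, i) x. (x \<bullet> b) * \<phi> i x"])
    fix x y :: 'b assume xy: "x \<in> sphere 0 1" "y \<in> sphere 0 1"
    have "poly ([:0, 1:] ^ Suc k) (x \<bullet> y) = (\<Sum>b\<in>Basis. (x \<bullet> b) * (y \<bullet> b)) * (\<Sum>i<N. \<phi> i x * \<phi> i y)"
      using eq[OF xy] by (simp add: euclidean_inner[of x y])
    also have "\<dots> = (\<Sum>(b, i)\<in>Basis \<times> {..<N}. ((x \<bullet> b) * (y \<bullet> b)) * (\<phi> i x * \<phi> i y))"
      by (simp add: sum_product sum.cartesian_product)
    finally show "poly ([:0, 1:] ^ Suc k) (x \<bullet> y) =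
      (\<Sum>i\<in>Basis \<times> {..<N}. (case i of (b, i) \<Rightarrow> \<lambda>x. x \<bullet> b * \<phi> i x) x * (case i of (b, i) \<Rightarrow> \<lambda>x. x \<bullet> b * \<phi> i x) y)"
      by (simp add: case_prod_beta algebra_simps)
  next
    fix i :: "'b \<times> nat" assume "i \<in> Basis \<times> {..<N}"
    then show "real_polynomial_function (case i of (b, i) \<Rightarrow> \<lambda>x. x \<bullet> b * \<phi> i x)"
      using N by (auto intro!: real_polynomial_function.intros(4)
          intro: real_polynomial_function.intros(1) bounded_linear_inner_left)
  qed simp
qed

text \<open>By the symmetry of the inner product, the second application of the operator can be made
  in the other variable. Both factors of each summand thus become
  \<open>sphere_op \<mu> (\<phi> i)\<close>, again polynomial.\<close>

lemma sphere_gram_op: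
  fixes \<mu> :: real
  defines "T \<equiv> \<lambda>p. gegenbauer_op (real DIM('b::euclidean_space) - 1) p + smult \<mu> p"
  assumes "sphere_gram TYPE('b) p"
  shows "sphere_gram TYPE('b) (T (T p))"
proof -
  obtain N :: nat and \<phi> where N[rule_format]: "\<forall>i<N. real_polynomial_function (\<phi> i :: 'b \<Rightarrow> real)"
    and eq[rule_format]: "\<forall>x\<in>sphere 0 1. \<forall>y\<in>sphere 0 1. poly p (x \<bullet> y) = (\<Sum>i<N. \<phi> i x * \<phi> i y)"
    using assms(2) unfolding sphere_gram_def by blast
  have T_eq: "T q = gegenbauer_op (real DIM('b) - 1) q + smult \<mu> q" for q by (simp add: T_def)
  have 1: "poly (T p) (x \<bullet> y) = (\<Sum>i<N. sphere_op \<mu> (\<phi> i) x * \<phi> i y)"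
    if "x \<in> sphere 0 1" "y \<in> sphere 0 1" for x y
    unfolding T_def using that N eq by (intro sphere_op_zonal) auto
  have 2: "poly (T p) (z \<bullet> x) = (\<Sum>i<N. \<phi> i z * sphere_op \<mu> (\<phi> i) x)"
    if "x \<in> sphere 0 1" "z \<in> sphere 0 1" for x z
    using 1[OF that] by (simp add: inner_commute[of z x] mult.commute)
  have "poly (T (T p)) (y \<bullet> x) = (\<Sum>i<N. sphere_op \<mu> (\<phi> i) y * sphere_op \<mu> (\<phi> i) x)"
    if "x \<in> sphere 0 1" "y \<in> sphere 0 1" for x y
    unfolding T_eq[of "T p"] using that N 2[OF that(1)] by (intro sphere_op_zonal) auto
  then show ?thesis
    using N by (intro sphere_gramI[of "{..<N}"]) (auto intro: real_polynomial_function_sphere_op)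
qed

lemma gegenbauer_op_sum_smult:
  "gegenbauer_op \<delta> (\<Sum>j\<in>A. smult (c j) (p j)) = (\<Sum>j\<in>A. smult (c j) (gegenbauer_op \<delta> (p j)))"
proof -
  have pd: "pderiv (\<Sum>j\<in>A. smult (c j) (q j)) = (\<Sum>j\<in>A. smult (c j) (pderiv (q j)))" for q :: "_ \<Rightarrow> real poly"
    by (induction A rule: infinite_finite_induct) (auto simp: pderiv_add pderiv_smult)
  show ?thesis
    unfolding gegenbauer_op_def pd
    by (induction A rule: infinite_finite_induct)
      (auto simp: smult_diff_right smult_add_right distrib_left mult.commute simp del: mult_pCons_left)
qed

text \<open>Starting from \<open>t ^ k\<close>, the square of the Gegenbauer operator shifted by its \<open>i\<close>-th eigenvalue
  removes the component along the \<open>i\<close>-th Gegenbauer polynomial, for \<open>i = 0, \<dots>, k - 1\<close> in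
  turn. The square is what keeps the kernel a Gram kernel: one factor acts on each variable.\<close>

lemma sphere_gram_gegenbauer:
  assumes "\<alpha> > 0" "real DIM('b::euclidean_space) = 2 * \<alpha> + 2"
  shows "sphere_gram TYPE('b) (gegenbauer_poly \<alpha> k)"
proof -
  define lam where "lam j = real j * (real j + 2 * \<alpha>)" for j :: nat
  have lam: "lam i \<noteq> lam k" if "i < k" for i
  proof -
    have "real i * (real i + 2 * \<alpha>) < real k * (real k + 2 * \<alpha>)"
      using that assms by (intro mult_strict_mono) auto
    then show ?thesis by (simp add: lam_def)
  qed
  \<comment> \<open>Only the top coefficient needs a sign: the others are annihilated one by one,
    while \<open>c k\<close> is multiplied by the positive numbers \<open>(lam i - lam k)^2\<close>.
    At \<open>i = k\<close> it alone is left.\<close>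
  have "\<exists>c. c k > 0 \<and> sphere_gram TYPE('b) (\<Sum>j=i..k. smult (c j) (gegenbauer_poly \<alpha> j))" if "i \<le> k" for i
    using that
  proof (induction i)
    case 0
    have "degree ([:0, 1:] ^ k :: real poly) \<le> k" by (simp add: degree_power_eq)
    from gegenbauer_poly_expansion[OF assms(1) this] obtain b
      where b: "[:0, 1:] ^ k = (\<Sum>j\<le>k. smult (b j) (gegenbauer_poly \<alpha> j))"
        "b k * coeff (gegenbauer_poly \<alpha> k) k = coeff ([:0, 1:] ^ k) k" by blast
    have "coeff ([:0, 1:] ^ k :: real poly) k = 1"
      by (metis coeff_monom monom_altdef smult_1_left)
    with b(2) coeff_gegenbauer_poly_pos[OF assms(1), of k] have "b k > 0"
      by (metis zero_less_mult_pos2 zero_less_one)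
    then show ?case using b(1) sphere_gram_power[where 'b='b, of k]
      by (intro exI[of _ b]) (simp add: atLeast0AtMost)
  next
    case (Suc i)
    then obtain c where c: "c k > 0" "sphere_gram TYPE('b) (\<Sum>j=i..k. smult (c j) (gegenbauer_poly \<alpha> j))"
      by auto
    define T where "T p = gegenbauer_op (real DIM('b) - 1) p + smult (lam i) p" for p
    have T: "T (\<Sum>j=i..k. smult (e j) (gegenbauer_poly \<alpha> j)) =
        (\<Sum>j=i..k. smult (e j * (lam i - lam j)) (gegenbauer_poly \<alpha> j))" for e
    proof -
      have sm: "smult m (\<Sum>j\<in>A. p j) = (\<Sum>j\<in>A. smult m (p j))" for m :: real and A :: "nat set" and p
        by (induction A rule: infinite_finite_induct) (auto simp: smult_add_right)
      have "real DIM('b) - 1 = 2 * \<alpha> + 1" using assms by simp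
      then have "T (\<Sum>j=i..k. smult (e j) (gegenbauer_poly \<alpha> j)) =
        (\<Sum>j=i..k. smult (e j) (smult (- lam j) (gegenbauer_poly \<alpha> j)) + smult (lam i) (smult (e j) (gegenbauer_poly \<alpha> j)))"
        by (simp only: T_def gegenbauer_op_sum_smult gegenbauer_op_gegenbauer_poly lam_def[symmetric] sum.distrib sm)
      also have "\<dots> = (\<Sum>j=i..k. smult (e j * (lam i - lam j)) (gegenbauer_poly \<alpha> j))"
        by (intro sum.cong refl) (simp add: smult_add_left[symmetric] algebra_simps)
      finally show ?thesis .
    qed
    have "sphere_gram TYPE('b) (T (T (\<Sum>j=i..k. smult (c j) (gegenbauer_poly \<alpha> j))))"
      unfolding T_def using c(2) by (rule sphere_gram_op)
    then have "sphere_gram TYPE('b)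
       (\<Sum>j=i..k. smult (c j * (lam i - lam j) * (lam i - lam j)) (gegenbauer_poly \<alpha> j))"
      by (simp only: T)
    moreover have "(\<Sum>j=i..k. smult (c j * (lam i - lam j) * (lam i - lam j)) (gegenbauer_poly \<alpha> j)) =
       (\<Sum>j=Suc i..k. smult (c j * (lam i - lam j) * (lam i - lam j)) (gegenbauer_poly \<alpha> j))"
      using Suc.prems by (simp add: sum.atLeast_Suc_atMost)
    moreover have "c k * (lam i - lam k) * (lam i - lam k) > 0"
    proof -
      have "(lam i - lam k)\<^sup>2 > 0" using lam[of i] Suc.prems by simp
      then show ?thesis using c(1) by (simp add: power2_eq_square mult.assoc)
    qed
    ultimately show ?case
      by (intro exI[of _ "\<lambda>j. c j * (lam i - lam j) * (lam i - lam j)"]) simp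
  qed
  from this[of k] obtain c where c: "c > 0" "sphere_gram TYPE('b) (smult c (gegenbauer_poly \<alpha> k))" by auto
  from c(2) obtain N :: nat and \<phi> where N[rule_format]: "\<forall>i<N. real_polynomial_function (\<phi> i :: 'b \<Rightarrow> real)"
    and eq[rule_format]: "\<forall>x\<in>sphere 0 1. \<forall>y\<in>sphere 0 1.
      poly (smult c (gegenbauer_poly \<alpha> k)) (x \<bullet> y) = (\<Sum>i<N. \<phi> i x * \<phi> i y)"
    unfolding sphere_gram_def by blast
  show ?thesis
  proof (rule sphere_gramI[of "{..<N}" "\<lambda>i x. \<phi> i x / sqrt c"])
    fix x y :: 'b assume xy: "x \<in> sphere 0 1" "y \<in> sphere 0 1"
    show "poly (gegenbauer_poly \<alpha> k) (x \<bullet> y) = (\<Sum>i<N. \<phi> i x / sqrt c * (\<phi> i y / sqrt c))"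
      using eq[OF xy] c(1) by (simp add: sum_divide_distrib[symmetric] field_simps)
  qed (auto intro: N)
qed

lemma psd_on_gegenbauer:
  assumes "\<alpha> > 0" "real DIM('b::euclidean_space) = 2 * \<alpha> + 2"
  shows "psd_on (sphere 0 1) (\<lambda>x y :: 'b. of_real (gegenbauer \<alpha> k (x \<bullet> y)))"
proof -
  obtain N :: nat and \<phi> where "\<forall>i<N. real_polynomial_function (\<phi> i :: 'b \<Rightarrow> real)" and
    eq[rule_format]: "\<forall>x\<in>sphere (0::'b) 1. \<forall>y\<in>sphere 0 1.
      poly (gegenbauer_poly \<alpha> k) (x \<bullet> y) = (\<Sum>i<N. \<phi> i x * \<phi> i y)"
    using sphere_gram_gegenbauer[OF assms, of k] unfolding sphere_gram_def by blast
  define gs :: "('b \<Rightarrow> complex) list" where "gs = map (\<lambda>i x. of_real (\<phi> i x)) [0..<N]"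
  have "herm_form (\<lambda>_ _. 1) F c = (\<Sum>a\<in>F. c a) * cnj (\<Sum>a\<in>F. c a)" for F :: "'b set" and c
    by (simp add: herm_form_def sum_product cnj_sum)
  then have "herm_form (\<lambda>_ _. 1) F c = of_real ((cmod (\<Sum>a\<in>F. c a))\<^sup>2)" for F :: "'b set" and c
    by (simp only: complex_norm_square)
  then have "psd_on (sphere 0 1) (\<lambda>_ _ :: 'b. 1)"
    by (simp only: psd_on_def) (simp add: less_eq_complex_def del: of_real_power)
  from psd_on_mult_sum_gram[OF this, of gs]
  have "psd_on (sphere 0 1) (\<lambda>x y :: 'b. \<Sum>g\<leftarrow>gs. g x * cnj (g y))" by simp
  also have "?this \<longleftrightarrow> ?thesis"
    by (rule psd_on_cong)
      (use eq in \<open>simp add: gs_def o_def interv_sum_list_conv_sum_set_nat atLeast0LessThan\<close>)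
  finally show ?thesis .
qed

section \<open>Alternating sums and decay\<close>

text \<open>A geometric sum with ratio \<open>z\<close>, where \<open>z ^ (2 * L) = 1\<close>. The
  bound on \<open>q\<close> keeps the angle strictly between - pi and pi, so that
  \<open>z \<noteq> 1\<close>.\<close>

lemma alternating_sum_cis:
  fixes q :: int
  assumes "\<bar>q\<bar> < int L"
  shows "(\<Sum>j<2 * L. (- 1) ^ j * cis (real_of_int q * (pi * real j / real L))) = 0"
proof -
  define z where "z = - cis (real_of_int q * (pi / real L))"
  have L: "L > 0" using assms by simp
  have *: "(- 1) ^ j * cis (real_of_int q * (pi * real j / real L)) = z ^ j" for j
  proof -
    have "cis (real_of_int q * (pi * real j / real L)) = cis (real_of_int q * (pi / real L)) ^ j"
      by (subst Complex.DeMoivre) (simp add: mult_ac)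
    then show ?thesis by (simp only: z_def power_minus[of "cis _"])
  qed
  have "z ^ (2 * L) = cis (2 * pi * real_of_int q)"
  proof -
    have "z ^ (2 * L) = cis (real_of_int q * (pi / real L)) ^ (2 * L)" by (simp add: z_def)
    also have "\<dots> = cis (real (2 * L) * (real_of_int q * (pi / real L)))" by (rule Complex.DeMoivre)
    also have "real (2 * L) * (real_of_int q * (pi / real L)) = 2 * pi * real_of_int q"
      using L by simp
    finally show ?thesis .
  qed
  also have "\<dots> = 1" by (rule cis_multiple_2pi) simp
  finally have zL: "z ^ (2 * L) = 1" .
  have "z \<noteq> 1"
  proof
    assume "z = 1"
    then have "Re z = 1" by simp
    then have "cos (\<bar>real_of_int q * (pi / real L)\<bar>) = - 1"
      unfolding cos_abs_real by (simp add: z_def)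
    moreover have "\<bar>real_of_int q * (pi / real L)\<bar> < pi"
    proof -
      have "\<bar>real_of_int q\<bar> < real L" using assms by linarith
      then show ?thesis using L by (simp add: abs_mult field_simps)
    qed
    then have "cos pi < cos (\<bar>real_of_int q * (pi / real L)\<bar>)"
      by (intro cos_monotone_0_pi) auto
    ultimately show False by simp
  qed
  then show ?thesis unfolding * by (simp add: geometric_sum zL)
qed

text \<open>The additional frequency \<open>q\<close> carries the induction on \<open>m\<close>:
  each cosine factor shifts it by 1 up or down, and the bound pays for the shift.\<close>

lemma alternating_sum_cos_power_cis:
  fixes q :: int
  assumes "\<bar>q\<bar> + int m < int L"
  shows "(\<Sum>j<2 * L. (- 1) ^ j * of_real (cos (\<theta> - pi * real j / real L) ^ m) *
    cis (real_of_int q * (pi * real j / real L))) = 0"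
  using assms
proof (induction m arbitrary: q)
  case 0
  then show ?case using alternating_sum_cis[of q L] by simp
next
  case (Suc m)
  define x where "x j = pi * real j / real L" for j
  have cc: "of_real (cos (\<theta> - y)) * cis (real_of_int q * y) =
      cis \<theta> / 2 * cis (real_of_int (q - 1) * y) + cis (- \<theta>) / 2 * cis (real_of_int (q + 1) * y)" for y
  proof -
    have "complex_of_real (cos x) = (cis x + cis (- x)) / 2" for x
      by (simp add: complex_eq_iff)
    from this[of "\<theta> - y"] show ?thesis
      by (simp add: add_divide_distrib distrib_right cis_mult algebra_simps)
  qed
  have "(\<Sum>j<2 * L. (- 1) ^ j * of_real (cos (\<theta> - x j) ^ Suc m) * cis (real_of_int q * x j)) =
    cis \<theta> / 2 * (\<Sum>j<2 * L. (- 1) ^ j * of_real (cos (\<theta> - x j) ^ m) * cis (real_of_int (q - 1) * x j)) +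
    cis (- \<theta>) / 2 * (\<Sum>j<2 * L. (- 1) ^ j * of_real (cos (\<theta> - x j) ^ m) * cis (real_of_int (q + 1) * x j))"
    unfolding sum_distrib_left sum.distrib[symmetric]
  proof (intro sum.cong refl)
    fix j
    have "(- 1) ^ j * of_real (cos (\<theta> - x j) ^ Suc m) * cis (real_of_int q * x j) =
      (- 1) ^ j * of_real (cos (\<theta> - x j) ^ m) * (of_real (cos (\<theta> - x j)) * cis (real_of_int q * x j))"
      by simp
    also have "\<dots> = cis \<theta> / 2 * ((- 1) ^ j * of_real (cos (\<theta> - x j) ^ m) * cis (real_of_int (q - 1) * x j)) +
      cis (- \<theta>) / 2 * ((- 1) ^ j * of_real (cos (\<theta> - x j) ^ m) * cis (real_of_int (q + 1) * x j))"
      unfolding cc by (simp only: algebra_simps)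
    finally show "(- 1) ^ j * of_real (cos (\<theta> - x j) ^ Suc m) * cis (real_of_int q * x j) = \<dots>" .
  qed
  also have "\<dots> = 0"
    using Suc.IH[of "q - 1"] Suc.IH[of "q + 1"] Suc.prems unfolding x_def by simp
  finally show ?case unfolding x_def .
qed

lemma alternating_sum_poly_cos:
  assumes "degree p < L"
  shows "(\<Sum>j<2 * L. (- 1) ^ j * poly p (cos (\<theta> - pi * real j / real L))) = 0"
proof -
  have "(\<Sum>j<2 * L. (- 1) ^ j * cos (\<theta> - pi * real j / real L) ^ i) = 0" if "i \<le> degree p" for i
  proof -
    have "complex_of_real (\<Sum>j<2 * L. (- 1) ^ j * cos (\<theta> - pi * real j / real L) ^ i) = 0"
      using alternating_sum_cos_power_cis[of 0 i L \<theta>] that assms by simp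
    then show ?thesis by (simp only: of_real_eq_0_iff)
  qed
  note 0 = this
  have "(\<Sum>j<2 * L. (- 1) ^ j * poly p (cos (\<theta> - pi * real j / real L))) =
    (\<Sum>i\<le>degree p. coeff p i * (\<Sum>j<2 * L. (- 1) ^ j * cos (\<theta> - pi * real j / real L) ^ i))"
    unfolding poly_altdef sum_distrib_left by (subst sum.swap) (simp add: mult_ac)
  also have "\<dots> = 0" using 0 by simp
  finally show ?thesis .
qed

lemma alternating_sum_antiperiodic:
  fixes h :: "nat \<Rightarrow> real"
  assumes "\<And>j. h (j + L) = - h j"
  shows "(\<Sum>j<2 * L. h j) = 0"
proof -
  have "(\<Sum>j<L + n. h j) = (\<Sum>j<L. h j) + (\<Sum>j<n. h (j + L))" for n
    by (induction n) (simp_all add: add.commute)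
  from this[of L] show ?thesis by (simp add: assms sum_negf mult_2)
qed

text \<open>In the first case the product is a polynomial of degree less than \<open>L\<close>. In
  the second the terms \<open>j\<close> and \<open>j + L\<close>, which belong to opposite
  arguments, cancel.\<close>

lemma alternating_sum_gegenbauer_mult:
  assumes "L > 0" "k + l < L \<or> odd (k + l + L)"
  shows "(\<Sum>j<2 * L. (- 1) ^ j * (gegenbauer \<alpha> k (cos (\<theta> - pi * real j / real L)) *
    gegenbauer \<alpha> l (cos (\<theta> - pi * real j / real L)))) = 0"
  using assms(2)
proof
  assume "k + l < L"
  then have "degree (gegenbauer_poly \<alpha> k * gegenbauer_poly \<alpha> l) < L"
    using degree_mult_le[of "gegenbauer_poly \<alpha> k" "gegenbauer_poly \<alpha> l"]
      degree_gegenbauer_poly[of \<alpha> k] degree_gegenbauer_poly[of \<alpha> l] by linarith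
  from alternating_sum_poly_cos[OF this, of \<theta>] show ?thesis by simp
next
  assume odd: "odd (k + l + L)"
  have minus: "cos (\<theta> - pi * real (j + L) / real L) = - cos (\<theta> - pi * real j / real L)" for j
  proof -
    have "\<theta> - pi * real (j + L) / real L = (\<theta> - pi * real j / real L) - pi"
      using assms(1) by (simp add: field_simps)
    then show ?thesis by (simp only: cos_minus_pi)
  qed
  have "(- 1) ^ (j + L) * ((- 1) ^ k * (- 1) ^ l) = - ((- 1) ^ j :: real)" for j
  proof -
    have "(- 1) ^ (k + l + L) = (- 1 :: real)" using odd by (rule neg_one_odd_power)
    then have "(- 1) ^ j * ((- 1) ^ k * (- 1) ^ l * (- 1) ^ L) = (- 1) ^ j * (- 1 :: real)"
      by (simp only: power_add)
    then show ?thesis by (simp only: power_add mult_ac)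
  qed
  note sgn = this
  show ?thesis
  proof (rule alternating_sum_antiperiodic)
    fix j
    define t where "t = cos (\<theta> - pi * real j / real L)"
    have "(- 1) ^ (j + L) * (gegenbauer \<alpha> k (- t) * gegenbauer \<alpha> l (- t)) =
      ((- 1) ^ (j + L) * ((- 1) ^ k * (- 1) ^ l)) * (gegenbauer \<alpha> k t * gegenbauer \<alpha> l t)"
      by (simp only: gegenbauer_minus mult_ac)
    then show "(- 1) ^ (j + L) * (gegenbauer \<alpha> k (cos (\<theta> - pi * real (j + L) / real L)) *
        gegenbauer \<alpha> l (cos (\<theta> - pi * real (j + L) / real L))) =
       - ((- 1) ^ j * (gegenbauer \<alpha> k (cos (\<theta> - pi * real j / real L)) *
        gegenbauer \<alpha> l (cos (\<theta> - pi * real j / real L))))"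
      unfolding minus sgn t_def by simp
  qed
qed

text \<open>If \<open>k + l\<close> is large then so is \<open>k\<close> or \<open>l\<close>; the
  normalized value for that index is small and the other one is bounded.\<close>

lemma gegenbauer_mult_small:
  assumes "\<alpha> \<ge> 1 / 2" "finite S" "\<And>t. t \<in> S \<Longrightarrow> \<bar>t\<bar> < 1" "\<delta> > 0"
  obtains M where "\<And>k l t. k + l \<ge> M \<Longrightarrow> t \<in> S \<Longrightarrow>
    \<bar>gegenbauer \<alpha> k t * gegenbauer \<alpha> l t\<bar> \<le> \<delta> * (gegenbauer \<alpha> k 1 * gegenbauer \<alpha> l 1)"
proof -
  define r where "r t m = gegenbauer \<alpha> m t / gegenbauer \<alpha> m 1" for t m
  have pos: "gegenbauer \<alpha> m 1 > 0" for m using assms(1) by (intro gegenbauer_1_pos) simp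
  have "\<exists>M. \<forall>k l. k + l \<ge> M \<longrightarrow> \<bar>r t k * r t l\<bar> \<le> \<delta>" if "t \<in> S" for t
  proof -
    have lim: "r t \<longlonglongrightarrow> 0"
      unfolding r_def using assms that by (intro gegenbauer_quotient_tendsto_0) auto
    obtain B where B: "B > 0" "\<And>m. \<bar>r t m\<bar> \<le> B"
      using convergent_imp_Bseq[OF convergentI[OF lim]] unfolding Bseq_def by auto
    have "\<delta> / B > 0" using B assms by simp
    from LIMSEQ_D[OF lim this] obtain M where M: "\<And>m. m \<ge> M \<Longrightarrow> \<bar>r t m\<bar> < \<delta> / B" by auto
    have "\<bar>r t k * r t l\<bar> \<le> \<delta>" if "k \<ge> M \<or> l \<ge> M" for k l
    proof -
      have "\<bar>r t k\<bar> * \<bar>r t l\<bar> \<le> \<delta> / B * B" if "k \<ge> M" for k l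
        using M[OF that] B assms(4) by (intro mult_mono) auto
      from this[of k l] this[of l k] that show ?thesis
        using B(1) by (auto simp: abs_mult mult.commute)
    qed
    moreover have "k \<ge> M \<or> l \<ge> M" if "k + l \<ge> 2 * M" for k l using that by linarith
    ultimately show ?thesis by blast
  qed
  then obtain M where M: "\<And>t k l. t \<in> S \<Longrightarrow> k + l \<ge> M t \<Longrightarrow> \<bar>r t k * r t l\<bar> \<le> \<delta>" by metis
  show ?thesis
  proof (rule that[of "\<Sum>t\<in>S. M t"])
    fix k l t assume kl: "k + l \<ge> (\<Sum>t\<in>S. M t)" and t: "t \<in> S"
    have "M t \<le> (\<Sum>t\<in>S. M t)" using t assms(2) by (intro member_le_sum) auto
    with M[OF t, of k l] kl have "\<bar>r t k * r t l\<bar> \<le> \<delta>" by simp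
    then have "\<bar>gegenbauer \<alpha> k t * gegenbauer \<alpha> l t\<bar> / (gegenbauer \<alpha> k 1 * gegenbauer \<alpha> l 1) \<le> \<delta>"
      using pos[of k] pos[of l] by (simp add: r_def abs_mult)
    then show "\<bar>gegenbauer \<alpha> k t * gegenbauer \<alpha> l t\<bar> \<le> \<delta> * (gegenbauer \<alpha> k 1 * gegenbauer \<alpha> l 1)"
      using pos[of k] pos[of l] by (simp add: pos_divide_le_eq)
  qed
qed

section \<open>Products of zonal kernels\<close>

lemma herm_form_extend:
  assumes "finite F'" "F \<subseteq> F'" "\<And>z. z \<in> F' - F \<Longrightarrow> c z = 0"
  shows "herm_form K F' c = herm_form K F c"
proof -
  have "herm_form K F c = (\<Sum>a\<in>F. \<Sum>b\<in>F'. c a * K a b * cnj (c b))"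
    unfolding herm_form_def using assms by (intro sum.cong refl sum.mono_neutral_left) auto
  also have "\<dots> = herm_form K F' c"
    unfolding herm_form_def using assms by (intro sum.mono_neutral_left) auto
  finally show ?thesis by simp
qed

lemma herm_form_sums:
  assumes "\<And>a b. a \<in> F \<Longrightarrow> b \<in> F \<Longrightarrow> (\<lambda>k. K k a b) sums L a b"
  shows "(\<lambda>k. herm_form (K k) F c) sums herm_form L F c"
  unfolding herm_form_def using assms by (intro sums_sum sums_mult2 sums_mult) auto

lemma sums_complex_nonneg:
  fixes x :: "nat \<Rightarrow> complex"
  assumes "x sums s" "\<And>k. 0 \<le> x k"
  shows "0 \<le> s" "s = 0 \<longleftrightarrow> (\<forall>k. x k = 0)"
proof -
  have im: "Im (x k) = 0" and re: "0 \<le> Re (x k)" for k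
    using assms(2)[of k] by (auto simp: less_eq_complex_def)
  have "(\<lambda>k. Im (x k)) sums Im s" and R: "(\<lambda>k. Re (x k)) sums Re s"
    using assms(1) by (auto simp: sums_complex_iff)
  then have ims: "Im s = 0" using sums_unique2[of "\<lambda>_. 0" 0 "Im s"] by (simp add: im)
  have res: "0 \<le> Re s" using sums_le[OF _ sums_zero R] re by simp
  show "0 \<le> s" using ims res by (simp add: less_eq_complex_def)
  have "Re s = 0 \<longleftrightarrow> (\<forall>k. Re (x k) = 0)"
    using suminf_eq_zero_iff[OF sums_summable[OF R] re] sums_unique[OF R] by simp
  then show "s = 0 \<longleftrightarrow> (\<forall>k. x k = 0)"
    using im ims by (simp add: complex_eq_iff)
qed

text \<open>A kernel of fixed parity does not separate antipodes, so dominance can only be asked for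
  away from the antipodal pair, and the coefficients must have the parity of the kernel.\<close>

lemma antipodal_diagonally_dominant:
  fixes X :: "'b::real_normed_vector set" and D :: "'b \<Rightarrow> complex" and E :: "'b \<Rightarrow> 'b \<Rightarrow> real" and s :: real
  assumes X: "finite X" "\<And>x. x \<in> X \<Longrightarrow> - x \<in> X" "0 \<notin> X"
    and s: "s\<^sup>2 = 1" and e: "e > 0" and \<delta>: "\<delta> * real (card X) < 2" "\<delta> \<ge> 0"
    and D: "\<And>x. x \<in> X \<Longrightarrow> D (- x) = of_real s * D x"
    and diag: "\<And>z. z \<in> X \<Longrightarrow> E z z = e" "\<And>z. z \<in> X \<Longrightarrow> E (- z) z = s * e"
    and off: "\<And>x z. x \<in> X \<Longrightarrow> z \<in> X \<Longrightarrow> x \<noteq> z \<Longrightarrow> x \<noteq> - z \<Longrightarrow> \<bar>E x z\<bar> \<le> \<delta> * e"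
    and zero: "\<And>z. z \<in> X \<Longrightarrow> (\<Sum>x\<in>X. D x * of_real (E x z)) = 0"
    and x: "x \<in> X"
  shows "D x = 0"
proof -
  have "Max ((\<lambda>x. cmod (D x)) ` X) \<in> (\<lambda>x. cmod (D x)) ` X"
    using X(1) x by (intro Max_in) auto
  then obtain z where "z \<in> X" and max: "Max ((\<lambda>x. cmod (D x)) ` X) = cmod (D z)" by auto
  then have z: "z \<in> X" "\<And>x. x \<in> X \<Longrightarrow> cmod (D x) \<le> cmod (D z)"
    using X(1) by (auto simp flip: max)
  have zz: "z \<noteq> - z" "- z \<in> X"
  proof -
    have "z \<noteq> 0" using X(3) z(1) by blast
    then have "2 *\<^sub>R z \<noteq> 0" by simp
    then show "z \<noteq> - z" by (simp only: scaleR_2 eq_neg_iff_add_eq_0 not_False_eq_True)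
    show "- z \<in> X" using X(2) z(1) .
  qed
  define R where "R = X - {z, - z}"
  have XR: "X = insert z (insert (- z) R)" "z \<notin> insert (- z) R" "- z \<notin> R" "finite R"
    using zz z(1) X(1) by (auto simp: R_def)
  have "0 = (\<Sum>x\<in>insert z (insert (- z) R). D x * of_real (E x z))"
    using zero[OF z(1)] XR(1) by simp
  also have "\<dots> = D z * of_real e + (of_real s * D z * of_real (s * e) + (\<Sum>x\<in>R. D x * of_real (E x z)))"
    using XR(2-4) by (simp add: diag z(1) D)
  \<comment> \<open>As \<open>s^2 = 1\<close>, the antipode contributes as much as \<open>z\<close>
    itself, where \<open>cmod (D z)\<close> is maximal. This is the origin of the 2 in the bound on
    \<open>\<delta>\<close>.\<close>
  also have "of_real s * D z * of_real (s * e) = of_real (s\<^sup>2) * D z * of_real e"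
    by (simp add: power2_eq_square)
  finally have "2 * D z * of_real e = - (\<Sum>x\<in>R. D x * of_real (E x z))"
    using s by (simp add: add_eq_0_iff algebra_simps)
  then have "cmod (2 * D z * of_real e) = cmod (\<Sum>x\<in>R. D x * of_real (E x z))"
    by simp
  also have "\<dots> \<le> (\<Sum>x\<in>R. cmod (D z) * (\<delta> * e))"
  proof (rule sum_norm_le)
    fix x assume "x \<in> R"
    then have "x \<in> X" "x \<noteq> z" "x \<noteq> - z" by (auto simp: R_def)
    then show "cmod (D x * of_real (E x z)) \<le> cmod (D z) * (\<delta> * e)"
      using z off[of x z] by (auto simp: norm_mult intro!: mult_mono)
  qed
  also have "\<dots> = real (card R) * (cmod (D z) * (\<delta> * e))" by simp
  also have "\<dots> \<le> real (card X) * (cmod (D z) * (\<delta> * e))"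
    using X(1) \<delta> e by (intro mult_right_mono) (auto simp: R_def intro!: card_mono)
  finally have "(2 - \<delta> * real (card X)) * (cmod (D z) * e) \<le> 0"
    using e by (simp add: norm_mult algebra_simps)
  then have "cmod (D z) * e \<le> 0" using \<delta>(1) by (simp add: mult_le_0_iff)
  then have "cmod (D z) = 0" using e by (simp add: mult_le_0_iff)
  with z(2)[OF x] show ?thesis by simp
qed

section \<open>Zonal kernels and the simultaneous vanishing of their forms\<close>

definition zonal_term ::
  "real \<Rightarrow> ('g \<Rightarrow> 'g \<Rightarrow> complex) \<Rightarrow> nat \<Rightarrow> 'g \<times> 'b::euclidean_space \<Rightarrow> 'g \<times> 'b \<Rightarrow> complex" where
  "zonal_term \<alpha> A k p q = A (fst p) (fst q) * of_real (gegenbauer \<alpha> k (snd p \<bullet> snd q))"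

definition zonal_product ::
  "real \<Rightarrow> ('g \<Rightarrow> 'g \<Rightarrow> complex) \<Rightarrow> ('g \<Rightarrow> 'g \<Rightarrow> complex) \<Rightarrow> nat \<Rightarrow> nat \<Rightarrow>
    'g \<times> 'b::euclidean_space \<Rightarrow> 'g \<times> 'b \<Rightarrow> complex" where
  "zonal_product \<alpha> A B k l p q = zonal_term \<alpha> A k p q * zonal_term \<alpha> B l p q"

lemma zonal_product_altdef:
  "zonal_product \<alpha> A B k l (u, x) (v, y) =
     (A u v * B u v) * of_real (gegenbauer \<alpha> k (x \<bullet> y) * gegenbauer \<alpha> l (x \<bullet> y))"
  by (simp add: zonal_product_def zonal_term_def mult_ac)

lemma psd_on_zonal_term:
  assumes "\<alpha> > 0" "real DIM('b::euclidean_space) = 2 * \<alpha> + 2" "psd_on S A"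
  shows "psd_on (S \<times> sphere (0::'b) 1) (zonal_term \<alpha> A k)"
  unfolding zonal_term_def
  by (intro psd_on_mult psd_on_pullback[OF assms(3)] psd_on_pullback[OF psd_on_gegenbauer[OF assms(1,2)]]) auto

lemma psd_on_zonal_product:
  assumes "\<alpha> > 0" "real DIM('b::euclidean_space) = 2 * \<alpha> + 2" "psd_on S A" "psd_on S B"
  shows "psd_on (S \<times> sphere (0::'b) 1) (zonal_product \<alpha> A B k l)"
  unfolding zonal_product_def using assms by (intro psd_on_mult psd_on_zonal_term)

text \<open>\<open>nondeg\<close> renders the second assertion of the theorem: \<open>s\<close>
  encodes the parity of \<open>k + l\<close>, the arbitrary bound \<open>M\<close> the infinitude,
  and a nonnegative form is positive iff it is nonzero.\<close>

lemma zonal_product_forms_zero_imp: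
  fixes F :: "('g \<times> 'b::euclidean_space) set"
  assumes \<alpha>: "\<alpha> \<ge> 1 / 2" "real DIM('b) = 2 * \<alpha> + 2"
    and AB: "\<And>k. psd_on S (A k)" "\<And>l. psd_on S (B l)"
    and nondeg: "\<And>U c (s :: real) M. finite U \<Longrightarrow> U \<subseteq> S \<Longrightarrow> \<exists>u\<in>U. c u \<noteq> 0 \<Longrightarrow> s = 1 \<or> s = - 1 \<Longrightarrow>
      \<exists>k l. k + l \<ge> M \<and> (- 1) ^ (k + l) = s \<and> herm_form (\<lambda>u v. A k u v * B l u v) U c \<noteq> 0"
    and F: "finite F" "F \<subseteq> S \<times> sphere 0 1"
    and zero: "\<And>k l. herm_form (zonal_product \<alpha> (A k) (B l) k l) F c = 0"
    and p: "p \<in> F"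
  shows "c p = 0"
proof -
  define U where "U = fst ` F"
  define X where "X = snd ` F \<union> uminus ` snd ` F"
  \<comment> \<open>\<open>F\<close> is enlarged to the product of its group part with an
    antipodally closed set, and the coefficients are extended by 0.\<close>
  define c' where "c' z = (if z \<in> F then c z else 0)" for z
  have U: "finite U" "U \<subseteq> S" using F by (auto simp: U_def)
  have X: "finite X" "X \<subseteq> sphere 0 1" "\<And>x. x \<in> X \<Longrightarrow> - x \<in> X"
    using F by (auto simp: X_def intro: rev_image_eqI)
  have FUX: "F \<subseteq> U \<times> X"
  proof
    fix p assume "p \<in> F"
    then have "fst p \<in> U" "snd p \<in> X" by (simp_all add: U_def X_def)
    then show "p \<in> U \<times> X" by (simp add: mem_Times_iff)
  qed
  have norm: "norm x = 1" "x \<bullet> x = 1" if "x \<in> X" for x using X(2) that by (auto simp: norm_eq_1)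
  have null: "(\<Sum>(\<mu>, x)\<in>U \<times> X. c' (\<mu>, x) * zonal_product \<alpha> (A k) (B l) k l (\<mu>, x) (\<nu>, z)) = 0"
    if "\<nu> \<in> U" "z \<in> X" for k l \<nu> z
  proof -
    have "herm_form (zonal_product \<alpha> (A k) (B l) k l) (U \<times> X) c' =
        herm_form (zonal_product \<alpha> (A k) (B l) k l) F c'"
      using U(1) X(1) FUX by (intro herm_form_extend) (auto simp: c'_def)
    also have "\<dots> = herm_form (zonal_product \<alpha> (A k) (B l) k l) F c"
      by (intro herm_form_cong) (auto simp: c'_def)
    finally have "herm_form (zonal_product \<alpha> (A k) (B l) k l) (U \<times> X) c' = 0" by (simp add: zero)
    moreover have "U \<times> X \<subseteq> S \<times> sphere 0 1" using U X by blast
    moreover have "(\<nu>, z) \<in> S \<times> sphere 0 1" using that U X by blast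
    moreover have "finite (U \<times> X)" using U X by blast
    ultimately show ?thesis
      using psd_on_null[OF psd_on_zonal_product[OF _ \<alpha>(2) AB, of k l k l]] \<alpha>(1)
      by (auto simp: case_prod_unfold)
  qed
  \<comment> \<open>Up to a factor 2, the even part (\<open>s = 1\<close>) or odd part
    (\<open>s = - 1\<close>) of the coefficients in the spherical variable.\<close>
  define v where "v s x \<mu> = c' (\<mu>, x) + of_real s * c' (\<mu>, - x)" for s :: real and x \<mu>
  have sym: "(\<Sum>\<mu>\<in>U. v s x \<mu> * (A k \<mu> \<nu> * B l \<mu> \<nu>)) = 0"
    if s: "s = 1 \<or> s = - 1" "(- 1) ^ (k + l) = s" and x: "x \<in> X" and \<nu>: "\<nu> \<in> U"
      and small: "\<And>t. t \<in> {x \<bullet> z | x z. x \<in> X \<and> z \<in> X \<and> x \<noteq> z \<and> x \<noteq> - z} \<Longrightarrow>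
        \<bar>gegenbauer \<alpha> k t * gegenbauer \<alpha> l t\<bar> \<le> 1 / (real (card X) + 1) * (gegenbauer \<alpha> k 1 * gegenbauer \<alpha> l 1)"
    for s k l x \<nu>
  proof -
    \<comment> \<open>For a fixed column \<open>\<nu>\<close> the group variable is summed out;
      there remains a vector \<open>D\<close> on \<open>X\<close> that the spherical matrix
      \<open>E\<close> annihilates.\<close>
    define D where "D x = (\<Sum>\<mu>\<in>U. v s x \<mu> * (A k \<mu> \<nu> * B l \<mu> \<nu>))" for x
    define E where "E x z = gegenbauer \<alpha> k (x \<bullet> z) * gegenbauer \<alpha> l (x \<bullet> z)" for x z :: 'b
    have s2: "s\<^sup>2 = 1" "s * s = 1" using s(1) by auto
    have Em: "E (- x) z = s * E x z" for x z
      unfolding E_def s(2)[symmetric] by (simp add: gegenbauer_minus power_add)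
    have "D x = 0"
    proof (rule antipodal_diagonally_dominant[of X s "gegenbauer \<alpha> k 1 * gegenbauer \<alpha> l 1"
          "1 / (real (card X) + 1)" D E])
      show "0 \<notin> X" using norm(1) by fastforce
      show "gegenbauer \<alpha> k 1 * gegenbauer \<alpha> l 1 > 0"
        using \<alpha> by (intro mult_pos_pos gegenbauer_1_pos) auto
      show "1 / (real (card X) + 1) * real (card X) < 2" by (simp add: field_simps)
      show "D (- x) = of_real s * D x" for x
        unfolding D_def sum_distrib_left
        by (intro sum.cong refl) (use s(1) in \<open>auto simp: v_def algebra_simps\<close>)
      show "E z z = gegenbauer \<alpha> k 1 * gegenbauer \<alpha> l 1" if "z \<in> X" for z
        using norm that by (simp add: E_def)
      then show "E (- z) z = s * (gegenbauer \<alpha> k 1 * gegenbauer \<alpha> l 1)" if "z \<in> X" for z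
        using that by (simp add: Em)
      show "\<bar>E x z\<bar> \<le> 1 / (real (card X) + 1) * (gegenbauer \<alpha> k 1 * gegenbauer \<alpha> l 1)"
        if "x \<in> X" "z \<in> X" "x \<noteq> z" "x \<noteq> - z" for x z
        unfolding E_def by (rule small) (use that in blast)
      show "(\<Sum>x\<in>X. D x * of_real (E x z)) = 0" if z: "z \<in> X" for z
      proof -
        have *: "(\<Sum>x\<in>X. (\<Sum>\<mu>\<in>U. c' (\<mu>, x) * (A k \<mu> \<nu> * B l \<mu> \<nu>)) * of_real (E x z)) = 0"
        proof -
          have "(\<Sum>x\<in>X. (\<Sum>\<mu>\<in>U. c' (\<mu>, x) * (A k \<mu> \<nu> * B l \<mu> \<nu>)) * of_real (E x z)) =
            (\<Sum>\<mu>\<in>U. \<Sum>x\<in>X. c' (\<mu>, x) * zonal_product \<alpha> (A k) (B l) k l (\<mu>, x) (\<nu>, z))"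
            by (subst sum.swap) (simp add: zonal_product_altdef sum_distrib_right E_def mult.assoc)
          then show ?thesis using null[OF \<nu> z, of k l] by (simp add: sum.cartesian_product)
        qed
        \<comment> \<open>Reindexing by the antipode turns the reflected half of the sum into
          \<open>s\<close> times the original half.\<close>
        have "(\<Sum>x\<in>X. (\<Sum>\<mu>\<in>U. c' (\<mu>, - x) * (A k \<mu> \<nu> * B l \<mu> \<nu>)) * of_real (E x z)) =
          (\<Sum>x\<in>X. (\<Sum>\<mu>\<in>U. c' (\<mu>, x) * (A k \<mu> \<nu> * B l \<mu> \<nu>)) * of_real (E (- x) z))"
          by (rule sum.reindex_bij_witness[of _ uminus uminus]) (auto simp: X(3))
        also have "\<dots> = of_real s * (\<Sum>x\<in>X. (\<Sum>\<mu>\<in>U. c' (\<mu>, x) * (A k \<mu> \<nu> * B l \<mu> \<nu>)) * of_real (E x z))"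
          unfolding sum_distrib_left by (simp add: Em mult_ac)
        finally have **: "(\<Sum>x\<in>X. (\<Sum>\<mu>\<in>U. c' (\<mu>, - x) * (A k \<mu> \<nu> * B l \<mu> \<nu>)) * of_real (E x z)) = 0"
          using * by simp
        have "(\<Sum>x\<in>X. D x * of_real (E x z)) =
          (\<Sum>x\<in>X. (\<Sum>\<mu>\<in>U. c' (\<mu>, x) * (A k \<mu> \<nu> * B l \<mu> \<nu>)) * of_real (E x z)) +
          of_real s * (\<Sum>x\<in>X. (\<Sum>\<mu>\<in>U. c' (\<mu>, - x) * (A k \<mu> \<nu> * B l \<mu> \<nu>)) * of_real (E x z))"
          by (simp add: D_def v_def algebra_simps sum.distrib sum_distrib_left sum_distrib_right)
        then show ?thesis using * ** by simp
      qed
    qed (use X x s2 in auto)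
    then show ?thesis by (simp add: D_def)
  qed
  \<comment> \<open>Distinct, non-antipodal unit vectors have inner product strictly between -1 and
    1. As \<open>Ts\<close> is finite, one threshold \<open>M\<close> serves all pairs.\<close>
  define Ts where "Ts = {x \<bullet> z | x z. x \<in> X \<and> z \<in> X \<and> x \<noteq> z \<and> x \<noteq> - z}"
  have "Ts \<subseteq> (\<lambda>(x, z). x \<bullet> z) ` (X \<times> X)" by (auto simp: Ts_def)
  then have "finite Ts" using X(1) by (meson finite_SigmaI finite_imageI finite_subset)
  moreover have "\<bar>t\<bar> < 1" if t: "t \<in> Ts" for t
  proof -
    obtain x z where xz: "t = x \<bullet> z" "x \<in> X" "z \<in> X" "x \<noteq> z" "x \<noteq> - z" using t by (auto simp: Ts_def)
    have "\<bar>x \<bullet> z\<bar> \<le> 1" using Cauchy_Schwarz_ineq2[of x z] norm xz by simp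
    moreover have "x \<bullet> z \<noteq> 1" "x \<bullet> z \<noteq> - 1"
    proof -
      have "(x - z) \<bullet> (x - z) = 2 - 2 * (x \<bullet> z)" "(x + z) \<bullet> (x + z) = 2 + 2 * (x \<bullet> z)"
        using norm xz by (simp_all add: inner_diff_left inner_diff_right inner_add_left inner_add_right inner_commute)
      moreover have "x - z \<noteq> 0" "x + z \<noteq> 0" using xz by (auto simp: eq_neg_iff_add_eq_0)
      ultimately show "x \<bullet> z \<noteq> 1" "x \<bullet> z \<noteq> - 1" by auto
    qed
    ultimately show ?thesis using xz(1) by linarith
  qed
  ultimately obtain M where M: "\<And>k l t. k + l \<ge> M \<Longrightarrow> t \<in> Ts \<Longrightarrow>
      \<bar>gegenbauer \<alpha> k t * gegenbauer \<alpha> l t\<bar> \<le> 1 / (real (card X) + 1) * (gegenbauer \<alpha> k 1 * gegenbauer \<alpha> l 1)"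
    using gegenbauer_mult_small[OF \<alpha>(1), of Ts "1 / (real (card X) + 1)"] by auto
  have v0: "v s x \<mu> = 0" if s: "s = 1 \<or> s = - 1" and x: "x \<in> X" and \<mu>: "\<mu> \<in> U" for s x \<mu>
  proof (rule ccontr)
    assume "v s x \<mu> \<noteq> 0"
    then obtain k l where kl: "k + l \<ge> M" "(- 1) ^ (k + l) = s"
      and ne: "herm_form (\<lambda>u v. A k u v * B l u v) U (v s x) \<noteq> 0"
      using nondeg[OF U, of "v s x" s M] \<mu> s by blast
    have "herm_form (\<lambda>u v. A k u v * B l u v) U (v s x) =
        (\<Sum>\<nu>\<in>U. (\<Sum>\<mu>\<in>U. v s x \<mu> * (A k \<mu> \<nu> * B l \<mu> \<nu>)) * cnj (v s x \<nu>))"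
      unfolding herm_form_def by (subst sum.swap) (simp add: sum_distrib_right)
    also have "\<dots> = 0"
      using sym[OF s kl(2) x] M[OF kl(1)] unfolding Ts_def by simp
    finally show False using ne by simp
  qed
  obtain u x where ux: "p = (u, x)" "u \<in> U" "x \<in> X" using p FUX by (cases p) auto
  \<comment> \<open>The even and odd parts together recover the coefficients.\<close>
  have "2 * c' (u, x) = v 1 x u + v (- 1) x u" by (simp add: v_def)
  also have "\<dots> = 0" using v0 ux by simp
  finally show ?thesis using p ux(1) by (simp add: c'_def)
qed

text \<open>The witness is supported on the vertices of a regular \<open>2L\<close>-gon in a coordinate plane,
  with alternating weights: these annihilate all polynomials of degree less than \<open>L\<close> and all
  polynomials of the parity opposite to that of \<open>L\<close>.\<close>

lemma zonal_product_forms_zero_witness: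
  fixes c :: "'g \<Rightarrow> complex"
  assumes dim: "DIM('b::euclidean_space) \<ge> 2" and L: "L > 0"
    and U: "finite U" "u0 \<in> U" "c u0 \<noteq> 0"
    and zero: "\<And>k l. k + l \<ge> L \<Longrightarrow> even (k + l + L) \<Longrightarrow> herm_form (\<lambda>u v. A k u v * B l u v) U c = 0"
  obtains F and C :: "'g \<times> 'b::euclidean_space \<Rightarrow> complex" where "finite F" "F \<subseteq> U \<times> sphere 0 1" "\<exists>p\<in>F. C p \<noteq> 0"
    "\<forall>k l. herm_form (zonal_product \<alpha> (A k) (B l) k l) F C = 0"
proof -
  obtain e1 e2 :: 'b where e: "e1 \<in> Basis" "e2 \<in> Basis" "e1 \<noteq> e2"
    using dim by (metis card_2_iff' ex_card nonempty_Basis obtain_subset_with_card_n subsetD)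
  define \<theta> where "\<theta> j = pi * real j / real L" for j
  define y where "y j = cos (\<theta> j) *\<^sub>R e1 + sin (\<theta> j) *\<^sub>R e2" for j
  define h :: "'g \<times> nat \<Rightarrow> 'g \<times> 'b" where "h = (\<lambda>(u, j). (u, y j))"
  define I where "I = U \<times> {..<2 * L}"
  define w where "w = (\<lambda>(u, j). c u * (- 1) ^ j)"
  \<comment> \<open>The weights are summed over the fibres of \<open>h\<close>, so that
    \<open>herm_form_pullback\<close> lets the form be computed on the index set
    \<open>I\<close>.\<close>
  define C where "C q = (\<Sum>z\<in>{z\<in>I. h z = q}. w z)" for q
  have yy: "y i \<bullet> y j = cos (\<theta> i - \<theta> j)" for i j
    using e by (simp add: y_def inner_add_left inner_add_right inner_Basis cos_diff)
  have I: "finite I" using U by (simp add: I_def)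
  show ?thesis
  proof (rule that[of "h ` I" C])
    show "finite (h ` I)" using I by simp
    have "norm (y j) = 1" for j using yy[of j j] by (simp add: norm_eq_1)
    then show "h ` I \<subseteq> U \<times> sphere 0 1" by (auto simp: h_def I_def)
    \<comment> \<open>One fibre that consists of a single index is enough to see that
      \<open>C\<close> is not identically zero.\<close>
    have "{z\<in>I. h z = (u0, y 0)} = {(u0, 0)}"
    proof -
      have "j = 0" if "j < 2 * L" "y j = y 0" for j
      proof (rule ccontr)
        assume "j \<noteq> 0"
        have "cos (\<theta> j) = 1" using yy[of j 0] yy[of 0 0] that(2) by (simp add: \<theta>_def)
        then obtain n :: int where n: "\<theta> j = of_int n * 2 * pi" by (auto simp: cos_one_2pi_int)
        then have "pi * (real j / real L) = pi * (of_int n * 2)" by (simp add: \<theta>_def)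
        then have "real j / real L = of_int n * 2" by (simp only: mult_left_cancel[OF pi_neq_zero])
        then have "real_of_int (int j) = real_of_int (n * (2 * int L))"
          using L by (simp add: field_simps)
        then have jn: "int j = n * (2 * int L)" by (simp only: of_int_eq_iff)
        then have "0 < n * (2 * int L)" using \<open>j \<noteq> 0\<close> by linarith
        then have "1 \<le> n" using L by (simp add: zero_less_mult_iff)
        then have "1 * (2 * int L) \<le> n * (2 * int L)" by (intro mult_right_mono) auto
        with that(1) jn show False by linarith
      qed
      then show ?thesis using U L by (auto simp: I_def h_def)
    qed
    then have "C (u0, y 0) = c u0" by (simp add: C_def w_def)
    moreover have "(u0, y 0) \<in> h ` I" using U L by (force simp: I_def h_def)
    ultimately show "\<exists>p\<in>h ` I. C p \<noteq> 0" using U by metis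
    show "\<forall>k l. herm_form (zonal_product \<alpha> (A k) (B l) k l) (h ` I) C = 0"
    proof (intro allI)
    fix k l
    let ?AB = "\<lambda>u v. A k u v * B l u v"
    define P where "P x = gegenbauer \<alpha> k x * gegenbauer \<alpha> l x" for x
    have "herm_form (zonal_product \<alpha> (A k) (B l) k l) (h ` I) C =
        herm_form (\<lambda>z w. zonal_product \<alpha> (A k) (B l) k l (h z) (h w)) I w"
      unfolding C_def[abs_def] by (rule herm_form_pullback[OF I, symmetric])
    also have "\<dots> = (\<Sum>(u, i)\<in>I. \<Sum>(v, j)\<in>I. (c u * ?AB u v * cnj (c v)) *
        of_real ((- 1) ^ i * ((- 1) ^ j * P (cos (\<theta> i - \<theta> j)))))"
      unfolding herm_form_def
      by (intro sum.cong refl)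
        (auto simp: h_def w_def zonal_product_altdef yy P_def intro!: sum.cong)
    also have "\<dots> = (\<Sum>u\<in>U. \<Sum>i<2 * L. \<Sum>v\<in>U. \<Sum>j<2 * L. (c u * ?AB u v * cnj (c v)) *
        of_real ((- 1) ^ i * ((- 1) ^ j * P (cos (\<theta> i - \<theta> j)))))"
      unfolding I_def by (simp add: sum.cartesian_product[symmetric])
    also have "\<dots> = (\<Sum>u\<in>U. \<Sum>v\<in>U. \<Sum>i<2 * L. \<Sum>j<2 * L. (c u * ?AB u v * cnj (c v)) *
        of_real ((- 1) ^ i * ((- 1) ^ j * P (cos (\<theta> i - \<theta> j)))))"
      by (intro sum.cong refl sum.swap)
    also have "\<dots> = herm_form ?AB U c *
        of_real (\<Sum>i<2 * L. (- 1) ^ i * (\<Sum>j<2 * L. (- 1) ^ j * P (cos (\<theta> i - \<theta> j))))"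
    proof -
      have "(\<Sum>i<2 * L. \<Sum>j<2 * L. x * of_real ((- 1) ^ i * ((- 1) ^ j * P (cos (\<theta> i - \<theta> j))))) =
          x * of_real (\<Sum>i<2 * L. (- 1) ^ i * (\<Sum>j<2 * L. (- 1) ^ j * P (cos (\<theta> i - \<theta> j))))" for x :: complex
        by (simp only: sum_distrib_left of_real_sum)
      then show ?thesis unfolding herm_form_def by (simp only: sum_distrib_right)
    qed
    also have "\<dots> = 0"
    \<comment> \<open>Either the alternating sum over the polygon vanishes, or \<open>k + l\<close>
      is at least \<open>L\<close> and of its parity, where the group factor vanishes by
      assumption.\<close>
    proof (cases "k + l < L \<or> odd (k + l + L)")
      case True
      have "(\<Sum>j<2 * L. (- 1) ^ j * P (cos (\<theta> i - \<theta> j))) = 0" for i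
        using alternating_sum_gegenbauer_mult[OF L True, of \<alpha> "\<theta> i"] unfolding P_def \<theta>_def .
      then show ?thesis by simp
    next
      case False
      then show ?thesis using zero[of k l] by simp
    qed
    finally show "herm_form (zonal_product \<alpha> (A k) (B l) k l) (h ` I) C = 0" .
    qed
  qed
qed

text \<open>The product is expanded one factor at a time: \<open>H k\<close> pairs one term of the
  first series with the full second function. Nonnegative inner terms give nonnegative inner sums,
  and a series of nonnegative terms is 0 only if every term is.\<close>

lemma zonal_series_product_form:
  fixes F :: "('g \<times> 'b::euclidean_space) set"
  assumes \<alpha>: "\<alpha> > 0" "real DIM('b) = 2 * \<alpha> + 2"
    and AB: "\<And>k. psd_on S (A k)" "\<And>l. psd_on S (B l)"
    and \<phi>: "\<And>u v t. u \<in> S \<Longrightarrow> v \<in> S \<Longrightarrow> t \<in> {-1..1} \<Longrightarrow>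
      (\<lambda>k. A k u v * of_real (gegenbauer \<alpha> k t)) sums \<phi> u v t"
    and \<psi>: "\<And>u v t. u \<in> S \<Longrightarrow> v \<in> S \<Longrightarrow> t \<in> {-1..1} \<Longrightarrow>
      (\<lambda>k. B k u v * of_real (gegenbauer \<alpha> k t)) sums \<psi> u v t"
    and F: "finite F" "F \<subseteq> S \<times> sphere 0 1"
    and K: "\<And>p q. p \<in> F \<Longrightarrow> q \<in> F \<Longrightarrow>
      K p q = \<phi> (fst p) (fst q) (snd p \<bullet> snd q) * \<psi> (fst p) (fst q) (snd p \<bullet> snd q)"
  shows "0 \<le> herm_form K F c"
    and "herm_form K F c = 0 \<longleftrightarrow> (\<forall>k l. herm_form (zonal_product \<alpha> (A k) (B l) k l) F c = 0)"
proof -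
  define H where "H k p q = zonal_term \<alpha> (A k) k p q * \<psi> (fst p) (fst q) (snd p \<bullet> snd q)" for k and p q :: "'g \<times> 'b"
  have t: "fst p \<in> S" "snd p \<bullet> snd q \<in> {-1..1}" if "p \<in> F" "q \<in> F" for p q
  proof -
    have "p \<in> S \<times> sphere 0 1" "q \<in> S \<times> sphere 0 1" using that F by auto
    then show "fst p \<in> S" "snd p \<bullet> snd q \<in> {-1..1}"
      using Cauchy_Schwarz_ineq2[of "snd p" "snd q"] by (auto simp: mem_Times_iff abs_le_iff)
  qed
  have outer: "(\<lambda>k. herm_form (H k) F c) sums herm_form K F c"
  proof (rule herm_form_sums)
    fix p q assume pq: "p \<in> F" "q \<in> F"
    show "(\<lambda>k. H k p q) sums K p q"
      unfolding H_def K[OF pq] zonal_term_def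
      using t pq by (intro sums_mult2 \<phi>) auto
  qed
  have inner: "(\<lambda>l. herm_form (zonal_product \<alpha> (A k) (B l) k l) F c) sums herm_form (H k) F c" for k
  proof (rule herm_form_sums)
    fix p q assume pq: "p \<in> F" "q \<in> F"
    show "(\<lambda>l. zonal_product \<alpha> (A k) (B l) k l p q) sums H k p q"
      unfolding H_def zonal_product_def zonal_term_def
      using t pq by (intro sums_mult \<psi>) auto
  qed
  have nonneg: "0 \<le> herm_form (zonal_product \<alpha> (A k) (B l) k l) F c" for k l
    using F by (intro psd_onD[OF psd_on_zonal_product[OF \<alpha> AB]])
  note 1 = sums_complex_nonneg[OF inner nonneg]
  note 2 = sums_complex_nonneg[OF outer 1(1)]
  show "0 \<le> herm_form K F c" by (rule 2(1))
  show "herm_form K F c = 0 \<longleftrightarrow> (\<forall>k l. herm_form (zonal_product \<alpha> (A k) (B l) k l) F c = 0)"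
    using 1(2) 2(2) by simp
qed

section \<open>Strict positive definiteness of the product and the parity condition\<close>

theorem theorem4p2:
  fixes G :: "('g, 'm) monoid_scheme" (structure)
    and T :: "'g topology"
    and d :: nat
    and f g :: "'g \<Rightarrow> real \<Rightarrow> complex"
    and a b :: "nat \<Rightarrow> 'g \<Rightarrow> complex"
    and Kf Kg :: "'g \<times> (real ^ 'n) \<Rightarrow> 'g \<times> (real ^ 'n) \<Rightarrow> complex"
  assumes "d \<ge> 2"
    and "CARD('n) = d + 1"
    and "locally_compact_group G T"
    and "isotropic_part G T f Kf"
    and "positive_definite_on (carrier G \<times> sphere 0 1) Kf"
    and "isotropic_part G T g Kg"
    and "positive_definite_on (carrier G \<times> sphere 0 1) Kg"
    and "gegenbauer_series G T d f a"
    and "gegenbauer_series G T d g b"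
  shows
    "(\<exists>K :: 'g \<times> (real ^ 'n) \<Rightarrow> 'g \<times> (real ^ 'n) \<Rightarrow> complex.
        isotropic_part G T (\<lambda>u t. f u t * g u t) K \<and>
        strictly_positive_definite_on (carrier G \<times> sphere 0 1) K)
     \<longleftrightarrow>
     (\<forall>p\<ge>1. \<forall>(u :: nat \<Rightarrow> 'g) (c :: nat \<Rightarrow> complex).
        u ` {..<p} \<subseteq> carrier G \<and> inj_on u {..<p} \<and> (\<exists>\<mu><p. c \<mu> \<noteq> 0) \<longrightarrow>
        (let N = {k + l | k l :: nat.
                   0 < sesq_form p (\<lambda>\<mu> \<nu>. a k (inv (u \<mu>) \<otimes> u \<nu>) * b l (inv (u \<mu>) \<otimes> u \<nu>)) c}
         in infinite {m \<in> N. even m} \<and> infinite {m \<in> N. odd m}))"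
    (is "?spd \<longleftrightarrow> ?cond")
proof -
  define \<alpha> where "\<alpha> = (real d - 1) / 2"
  have \<alpha>: "\<alpha> \<ge> 1 / 2" "\<alpha> > 0" "real DIM(real ^ 'n) = 2 * \<alpha> + 2"
    using assms(1,2) by (auto simp: \<alpha>_def field_simps)
  have dim: "DIM(real ^ 'n) \<ge> 2" using assms(1,2) by simp
  interpret group G using assms(3) by (simp add: locally_compact_group_def)
  define A where "A k u v = a k (inv u \<otimes> v)" for k u v
  define B where "B k u v = b k (inv u \<otimes> v)" for k u v
  define AB where "AB k l u v = A k u v * B l u v" for k l u v
  define \<phi> where "\<phi> u v t = f (inv u \<otimes> v) t" for u v t
  define \<psi> where "\<psi> u v t = g (inv u \<otimes> v) t" for u v t
  have psd: "psd_on (carrier G) (A k)" "psd_on (carrier G) (B k)" for k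
    using assms(8,9) by (simp_all add: gegenbauer_series_def positive_definite_on_iff A_def[abs_def] B_def[abs_def])
  have series: "(\<lambda>k. A k u v * of_real (gegenbauer \<alpha> k t)) sums \<phi> u v t"
    "(\<lambda>k. B k u v * of_real (gegenbauer \<alpha> k t)) sums \<psi> u v t"
    if "u \<in> carrier G" "v \<in> carrier G" "t \<in> {-1..1}" for u v t
    using assms(8,9) that unfolding gegenbauer_series_def A_def B_def \<phi>_def \<psi>_def \<alpha>_def by simp_all
  have psdAB: "psd_on (carrier G) (AB k l)" for k l
    unfolding AB_def[abs_def] by (intro psd_on_mult psd)
  have sesq: "sesq_form p (\<lambda>\<mu> \<nu>. a k (inv (u \<mu>) \<otimes> u \<nu>) * b l (inv (u \<mu>) \<otimes> u \<nu>)) c =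
      herm_form (AB k l) (u ` {..<p}) (\<lambda>x. c (the_inv_into {..<p} u x))"
    if "inj_on u {..<p}" for p k l and u :: "nat \<Rightarrow> 'g" and c
    using sesq_form_herm_form[OF that, of "AB k l" c] by (simp add: AB_def A_def B_def)
  have iso: "K p q = \<phi> (fst p) (fst q) (snd p \<bullet> snd q) * \<psi> (fst p) (fst q) (snd p \<bullet> snd q)"
    if "isotropic_part G T (\<lambda>u t. f u t * g u t) K" "F \<subseteq> carrier G \<times> sphere 0 1" "p \<in> F" "q \<in> F"
    for K :: "'g \<times> (real ^ 'n) \<Rightarrow> 'g \<times> (real ^ 'n) \<Rightarrow> complex" and F p q
  proof -
    have "p \<in> carrier G \<times> sphere 0 1" "q \<in> carrier G \<times> sphere 0 1" using that by auto
    moreover obtain u x v y where "p = (u, x)" "q = (v, y)" by (cases p, cases q)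
    ultimately show ?thesis
      using that(1) by (simp add: isotropic_part_def cos_sphere_dist \<phi>_def \<psi>_def del: mem_sphere_0)
  qed
  have form: "0 \<le> herm_form K F c"
    "herm_form K F c = 0 \<longleftrightarrow> (\<forall>k l. herm_form (zonal_product \<alpha> (A k) (B l) k l) F c = 0)"
    if F: "finite F" "F \<subseteq> carrier G \<times> sphere 0 1" and K: "isotropic_part G T (\<lambda>u t. f u t * g u t) K"
    for K :: "'g \<times> (real ^ 'n) \<Rightarrow> 'g \<times> (real ^ 'n) \<Rightarrow> complex" and F c
    by (rule zonal_series_product_form[where \<alpha> = \<alpha> and S = "carrier G" and A = A and B = B
          and \<phi> = \<phi> and \<psi> = \<psi>];
        (rule \<alpha> psd F | (rule series iso[OF K F(2)]; assumption)))+
  show ?thesis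
  proof
    assume ?spd
    then obtain K :: "'g \<times> (real ^ 'n) \<Rightarrow> 'g \<times> (real ^ 'n) \<Rightarrow> complex"
      where K: "isotropic_part G T (\<lambda>u t. f u t * g u t) K"
        and spd: "\<And>F c. finite F \<Longrightarrow> F \<subseteq> carrier G \<times> sphere 0 1 \<Longrightarrow> \<exists>p\<in>F. c p \<noteq> 0 \<Longrightarrow> 0 < herm_form K F c"
      by (auto simp: strictly_positive_definite_on_iff)
    \<comment> \<open>\<open>r = 0\<close> selects the even sums and \<open>r = 1\<close> the odd
      ones.\<close>
    have key: "infinite {m \<in> {k + l | k l. 0 < herm_form (AB k l) U c}. even (m + r)}"
      if U: "finite U" "U \<subseteq> carrier G" "u0 \<in> U" "c u0 \<noteq> 0" for U c u0 and r :: nat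
    proof
      define Q where "Q = {m \<in> {k + l | k l. 0 < herm_form (AB k l) U c}. even (m + r)}"
      assume "finite {m \<in> {k + l | k l. 0 < herm_form (AB k l) U c}. even (m + r)}"
      then obtain M where M: "\<forall>m\<in>Q. m < M"
        unfolding Q_def[symmetric] finite_nat_set_iff_bounded by (elim exE)
      \<comment> \<open>\<open>L\<close> is positive, lies beyond the bound \<open>M\<close> and has
        the parity of \<open>r\<close>.\<close>
      define L where "L = 2 * M + 2 + r"
      have zero: "herm_form (\<lambda>u v. A k u v * B l u v) U c = 0" if "k + l \<ge> L" "even (k + l + L)" for k l
      proof (rule ccontr)
        assume "herm_form (\<lambda>u v. A k u v * B l u v) U c \<noteq> 0"
        moreover have "0 \<le> herm_form (AB k l) U c" using psd_onD[OF psdAB U(1,2)] .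
        ultimately have "0 < herm_form (AB k l) U c" by (simp add: AB_def[abs_def] order_less_le)
        moreover have "even (k + l + r)" using that(2) by (simp add: L_def)
        ultimately have "k + l < M" by (intro M[rule_format]) (auto simp: Q_def)
        with that(1) show False by (simp add: L_def)
      qed
      obtain F and C :: "'g \<times> (real ^ 'n) \<Rightarrow> complex" where F: "finite F" "F \<subseteq> U \<times> sphere 0 1"
          "\<exists>p\<in>F. C p \<noteq> 0" "\<forall>k l. herm_form (zonal_product \<alpha> (A k) (B l) k l) F C = 0"
        by (rule zonal_product_forms_zero_witness[OF dim _ U(1,3,4) zero, where L = L and \<alpha> = \<alpha>]) (simp_all add: L_def)
      have FG: "F \<subseteq> carrier G \<times> sphere 0 1" using F(2) U(2) by blast
      have "herm_form K F C = 0" using form(2)[OF F(1) FG K] F(4) by simp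
      with spd[OF F(1) FG F(3)] show False by simp
    qed
    show ?cond
    proof (intro allI impI, elim conjE exE)
      fix p \<mu> :: nat and u :: "nat \<Rightarrow> 'g" and c assume p: "1 \<le> p" "u ` {..<p} \<subseteq> carrier G" "inj_on u {..<p}" "\<mu> < p" "c \<mu> \<noteq> (0::complex)"
      have "c (the_inv_into {..<p} u (u \<mu>)) \<noteq> 0"
        using p by (simp add: the_inv_into_f_f[OF p(3)])
      note key' = key[of "u ` {..<p}" "u \<mu>" "\<lambda>x. c (the_inv_into {..<p} u x)", OF _ p(2) _ this]
      show "let N = {k + l | k l. 0 < sesq_form p (\<lambda>\<mu> \<nu>. a k (inv (u \<mu>) \<otimes> u \<nu>) * b l (inv (u \<mu>) \<otimes> u \<nu>)) c}
         in infinite {m \<in> N. even m} \<and> infinite {m \<in> N. odd m}"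
        unfolding sesq[OF p(3)] Let_def using key'[of 0] key'[of 1] p(4) by simp
    qed
  next
    assume cond: ?cond
    define K :: "'g \<times> (real ^ 'n) \<Rightarrow> 'g \<times> (real ^ 'n) \<Rightarrow> complex" where
      "K p q = f (inv (fst p) \<otimes> fst q) (cos (sphere_dist (snd p) (snd q) / 2)) *
         g (inv (fst p) \<otimes> fst q) (cos (sphere_dist (snd p) (snd q) / 2))" for p q
    have K: "isotropic_part G T (\<lambda>u t. f u t * g u t) K"
      using assms(4,6)
      by (auto simp: isotropic_part_def K_def continuous_map_atin case_prod_unfold intro!: tendsto_mult)
    have nondeg: "\<exists>k l. k + l \<ge> M \<and> (- 1) ^ (k + l) = s \<and> herm_form (\<lambda>u v. A k u v * B l u v) U c \<noteq> 0"
      if U: "finite U" "U \<subseteq> carrier G" "\<exists>u\<in>U. c u \<noteq> 0" and s: "s = 1 \<or> s = - 1" for U c and s :: real and M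
    proof -
      obtain p and u :: "nat \<Rightarrow> 'g" where u: "U = u ` {..<p}" "inj_on u {..<p}"
        using ex_enumeration[OF U(1)] by metis
      obtain i where i: "i < p" "c (u i) \<noteq> 0" using U(3) u(1) by auto
      have sesq': "sesq_form p (\<lambda>\<mu> \<nu>. a k (inv (u \<mu>) \<otimes> u \<nu>) * b l (inv (u \<mu>) \<otimes> u \<nu>)) (\<lambda>i. c (u i)) =
          herm_form (AB k l) U c" for k l
        unfolding u(1) herm_form_image[OF u(2)] by (simp add: sesq_form_def herm_form_def AB_def A_def B_def)
      have sgn: "(- 1) ^ m = (1 :: real) \<longleftrightarrow> even m" "(- 1) ^ m = (- 1 :: real) \<longleftrightarrow> odd m" for m :: nat
        by (simp_all add: minus_one_power_iff)
      have "infinite {m \<in> {k + l | k l. 0 < herm_form (AB k l) U c}. even m}"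
        "infinite {m \<in> {k + l | k l. 0 < herm_form (AB k l) U c}. odd m}"
        using cond[rule_format, of p u "\<lambda>i. c (u i)"] i U(2) u unfolding sesq' Let_def by auto
      then have "infinite {m \<in> {k + l | k l. 0 < herm_form (AB k l) U c}. (- 1) ^ m = s}"
        using s by (elim disjE) (simp_all only: sgn not_False_eq_True)
      then obtain m where "m \<ge> M" "m \<in> {m \<in> {k + l | k l. 0 < herm_form (AB k l) U c}. (- 1) ^ m = s}"
        unfolding infinite_nat_iff_unbounded_le by blast
      then show ?thesis by (auto simp: AB_def[abs_def] order_less_le)
    qed
    have "0 < herm_form K F c" if F: "finite F" "F \<subseteq> carrier G \<times> sphere 0 1" "\<exists>p\<in>F. c p \<noteq> 0" for F c
    proof -
      have "herm_form K F c \<noteq> 0"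
        using zonal_product_forms_zero_imp[OF \<alpha>(1,3) psd nondeg F(1,2)] F(3)
          form(2)[OF F(1,2) K] by blast
      with form(1)[OF F(1,2) K] show ?thesis by (simp add: order_less_le)
    qed
    moreover have "psd_on (carrier G \<times> sphere 0 1) K"
      unfolding psd_on_def using form(1)[OF _ _ K] by blast
    ultimately show ?spd
      using K unfolding strictly_positive_definite_on_iff by (intro exI[of _ K]) blast
  qed
qed

end
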